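(* Let $P_0(z),\dots,P_n(z)$ be polynomials with complex coefficients such that there exists an integer $\ell$, $0\le\ell\le n$, with $$\deg(P_\ell)>\max_{\substack{0\le j\le n\\ j\ne\ell}}\deg(P_j).$$ Suppose $f\not\equiv0$ is a meromorphic function on $\mathbb{C}$ satisfying $$P_n(z)f(z+n)+\cdots+P_1(z)f(z+1)+P_0(z)f(z)=0.$$ Then $\sigma(f)\ge1$.
   Context: Meromorphic means meromorphic in the whole complex plane. $\sigma(g)$ denotes the order of growth of a meromorphic function $g$: $\sigma(g)=\limsup_{r\to\infty}\frac{\log^+T(r,g)}{\log r}\in[0,\infty]$, where $T(r,g)=m(r,g)+N(r,g)$ is the Nevanlinna characteristic, with $m(r,g)=\frac1{2\pi}\int_0^{2\pi}\log^+|g(re^{i\theta})|\,d\theta$, $N(r,g)=\int_0^r\frac{n(t,g)-n(0,g)}{t}\,dt+n(0,g)\log r$, and $n(t,g)$ the number of poles of $g$ in $|z|\le t$ with multiplicity. *)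

theory Defs
  imports "HOL-Complex_Analysis.Complex_Analysis"
begin

text \<open>
  The degree of the zero polynomial is \<open>-\<infinity>\<close> here, whereas \<^const>\<open>degree\<close> returns \<open>0\<close>.
  With values in \<^typ>\<open>ereal\<close>, the maximum of a finite set of degrees is its supremum, and the
  maximum of the empty set is \<open>-\<infinity>\<close>.
\<close>

definition poly_deg :: "complex poly \<Rightarrow> ereal" where
  "poly_deg p = (if p = 0 then -\<infinity> else ereal (real (degree p)))"

definition log_plus :: "real \<Rightarrow> real" where
  "log_plus x = ln (max 1 x)"

text \<open>
  The notions below are meant for functions \<open>g\<close> with \<open>g meromorphic_on UNIV\<close>. Such a \<open>g\<close> may
  take arbitrary values at its poles and at a set of further isolated points; none of these
  values influences the quantities defined here, since \<^const>\<open>is_pole\<close> and \<^const>\<open>zorder\<close>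
  only depend on punctured neighbourhoods and each circle contains only finitely many such points.
\<close>

definition proximity :: "(complex \<Rightarrow> complex) \<Rightarrow> real \<Rightarrow> real" where
  "proximity g r =
     1 / (2 * pi) * integral {0..2 * pi} (\<lambda>\<theta>. log_plus (cmod (g (of_real r * exp (\<i> * of_real \<theta>)))))"

text \<open>At a pole, \<^const>\<open>zorder\<close> is the negative of the multiplicity of the pole.\<close>

definition pole_count :: "(complex \<Rightarrow> complex) \<Rightarrow> real \<Rightarrow> nat" where
  "pole_count g t = (\<Sum>z\<in>{z. cmod z \<le> t \<and> is_pole g z}. nat (- zorder g z))"

definition integrated_pole_count :: "(complex \<Rightarrow> complex) \<Rightarrow> real \<Rightarrow> real" where
  "integrated_pole_count g r =
     integral {0..r} (\<lambda>t. (real (pole_count g t) - real (pole_count g 0)) / t)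
     + real (pole_count g 0) * ln r"

definition nevanlinna_char :: "(complex \<Rightarrow> complex) \<Rightarrow> real \<Rightarrow> real" where
  "nevanlinna_char g r = proximity g r + integrated_pole_count g r"

definition growth_order :: "(complex \<Rightarrow> complex) \<Rightarrow> ereal" where
  "growth_order g = Limsup at_top (\<lambda>r::real. ereal (log_plus (nevanlinna_char g r) / ln r))"

end

theory Submission imports Defs begin

text \<open>
  Suppose \<open>\<sigma>(f) < 1\<close>, so \<open>T(r, f) \<le> r\<^sup>\<rho>\<close> for some \<open>\<rho> < 1\<close> and all large \<open>r\<close>. On a disc of radius
  \<open>R\<close>, divide \<open>f\<close> by the Blaschke factors of its zeros and poles; what remains is \<open>exp h\<close> with
  \<open>\<bar>f\<bar> = exp (Re h)\<close> on the boundary circle. The value \<open>Re (h 0)\<close> gives Jensen's formula, which bounds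
  by \<open>O(R\<^sup>\<rho>)\<close> both the mean of \<open>\<bar>Re h\<bar>\<close> on the circle and the number of zeros and poles; the Schwarz
  integral then makes \<open>h (x + i) - h (x + j)\<close> of size \<open>O(R powr (\<rho> - 1))\<close>. The zeros and poles contribute terms
  \<open>ln (1 + n / \<bar>x + j - p\<bar>) \<le> C \<bar>x + j - p\<bar> powr - \<alpha>\<close> with \<open>\<rho> < \<alpha> < 1\<close>, and averaging over real \<open>x\<close> between
  \<open>R / 8\<close> and \<open>R / 4\<close> finds a point where their sum is \<open>O(R powr (\<rho> - \<alpha>))\<close>. So there are arbitrarily large \<open>x\<close>
  at which all the quotients \<open>f (x + i) / f (x + j)\<close> are bounded, and there the term with the polynomial of
  dominant degree cannot be cancelled by the others.
\<close>

subsection \<open>Integral formulas on a circle\<close>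

text \<open>Since \<open>cmod (cnj p * z) < R * R\<close>, the denominators of the Blaschke factors
  and of the reflected Cauchy kernel do not vanish on the closed disc.\<close>

lemma radius_square_neq_cnj_mult:
  assumes "cmod p < R" "cmod z \<le> R"
  shows "(of_real R)\<^sup>2 - cnj p * z \<noteq> 0"
proof
  assume "(of_real R)\<^sup>2 - cnj p * z = 0"
  then have "cmod (cnj p * z) = cmod ((of_real R)\<^sup>2)" by simp
  then have "cmod p * cmod z = R * R" by (simp add: norm_mult power2_eq_square)
  moreover have "cmod p * cmod z < R * R"
    using assms by (smt (verit) mult_left_mono mult_strict_right_mono norm_ge_zero)
  ultimately show False by simp
qed

text \<open>With \<open>\<zeta> = R * exp (\<i> * t)\<close> one has
  \<open>d\<zeta> = \<i> * \<zeta> dt\<close>, so the factor \<open>\<i>\<close> of Cauchy's formula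
  cancels and \<open>\<zeta>\<close> enters the numerator.\<close>

lemma Cauchy_integral_circle:
  assumes "h holomorphic_on cball 0 R" "cmod w < R"
  shows "((\<lambda>t. h (of_real R * exp (\<i> * of_real t)) * (of_real R * exp (\<i> * of_real t))
            / (of_real R * exp (\<i> * of_real t) - w)) has_integral of_real (2 * pi) * h w) {0..2 * pi}"
proof -
  have "((\<lambda>u. h u / (u - w)) has_contour_integral (2 * of_real pi * \<i> * h w)) (circlepath 0 R)"
    using Cauchy_integral_circlepath_simple[of h 0 R w] assms by simp
  then have "((\<lambda>t. h (of_real R * cis t) / (of_real R * cis t - w) * of_real R * \<i> * cis t)
      has_integral 2 * of_real pi * \<i> * h w) {0..2 * pi}"
    unfolding circlepath_def
    by (subst (asm) has_contour_integral_part_circlepath_iff) auto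
  from has_integral_mult_right[OF this, of "- \<i>"] show ?thesis
    by (simp add: cis_conv_exp algebra_simps)
qed

text \<open>On the circle the conjugated Cauchy kernel is again holomorphic inside, because
  \<open>cnj \<zeta> = R\<^sup>2 / \<zeta>\<close>; hence conjugate-holomorphic functions only contribute their value at the centre.\<close>

lemma Cauchy_integral_circle_cnj:
  assumes h: "h holomorphic_on cball 0 R" and w: "cmod w < R"
  shows "((\<lambda>t. cnj (h (of_real R * exp (\<i> * of_real t))) * (of_real R * exp (\<i> * of_real t))
            / (of_real R * exp (\<i> * of_real t) - w)) has_integral of_real (2 * pi) * cnj (h 0)) {0..2 * pi}"
proof -
  have R: "0 < R" using w by (smt (verit) norm_ge_zero)
  \<comment> \<open>On the circle \<open>g\<close> is the conjugate of the integrand, but it is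
    holomorphic on the whole closed disc. Its mean over the circle is therefore
    \<open>g 0 = h 0\<close>.\<close>
  define g where "g z = h z * (of_real R)\<^sup>2 / ((of_real R)\<^sup>2 - cnj w * z)" for z
  have "g holomorphic_on cball 0 R"
    unfolding g_def by (intro holomorphic_intros h) (use radius_square_neq_cnj_mult[OF w] in auto)
  from Cauchy_integral_circle[OF this, of 0] R
  have "((\<lambda>t. g (of_real R * exp (\<i> * of_real t))) has_integral of_real (2 * pi) * h 0) {0..2 * pi}"
    by (simp add: g_def)
  then have "((\<lambda>t. cnj (g (of_real R * exp (\<i> * of_real t)))) has_integral cnj (of_real (2 * pi) * h 0)) {0..2 * pi}"
    by (rule has_integral_cnj[unfolded o_def, THEN iffD2])
  moreover have "cnj (g z) = cnj (h z) * z / (z - w)" if "cmod z = R" for z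
  proof -
    have z: "z \<noteq> 0" "z \<noteq> w" using that w R by auto
    have sq: "(of_real R)\<^sup>2 = z * cnj z" using complex_norm_square[of z] that by simp
    have "cnj (g z) = cnj (h z) * (z * cnj z) / (z * cnj z - w * cnj z)"
      unfolding g_def sq by (simp add: mult.commute)
    also have "\<dots> = cnj (h z) * z / (z - w)"
      using z by (simp add: divide_simps) (simp add: algebra_simps)
    finally show ?thesis .
  qed
  ultimately show ?thesis
    using R by (simp add: norm_mult)
qed

lemma mean_value_Re:
  assumes h: "h holomorphic_on cball 0 R" and R: "0 < R"
  shows "((\<lambda>t. Re (h (of_real R * exp (\<i> * of_real t)))) has_integral 2 * pi * Re (h 0)) {0..2 * pi}"
proof -
  have "((\<lambda>t. h (of_real R * exp (\<i> * of_real t))) has_integral of_real (2 * pi) * h 0) {0..2 * pi}"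
    using Cauchy_integral_circle[OF h, of 0] R by simp
  from has_integral_Re[OF this] show ?thesis by simp
qed

text \<open>Half the sum of the two preceding formulas, because
  \<open>Re h = (h + cnj h) / 2\<close>. It recovers \<open>h\<close> inside the disc from its real
  part on the circle, up to the constant \<open>cnj (h 0)\<close>.\<close>

lemma Schwarz_integral_circle:
  assumes h: "h holomorphic_on cball 0 R" and w: "cmod w < R"
  shows "((\<lambda>t. of_real (Re (h (of_real R * exp (\<i> * of_real t)))) * (of_real R * exp (\<i> * of_real t))
            / (of_real R * exp (\<i> * of_real t) - w)) has_integral of_real pi * (h w + cnj (h 0))) {0..2 * pi}"
proof -
  have *: "of_real (Re z) * a / b = (1/2) * (z * a / b + cnj z * a / b)" for z a b :: complex
    proof -
    have "of_real (Re z) = (1/2) * (z + cnj z)" by (simp add: complex_add_cnj)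
    then show ?thesis by (simp add: add_divide_distrib algebra_simps)
  qed
  have "of_real pi * (h w + cnj (h 0)) = (1/2) * (of_real (2 * pi) * h w + of_real (2 * pi) * cnj (h 0))"
    by (simp add: algebra_simps)
  then show ?thesis
    unfolding * by (simp only:) (intro has_integral_mult_right has_integral_add
        Cauchy_integral_circle Cauchy_integral_circle_cnj assms)
qed

text \<open>Subtracting the Schwarz formulas at \<open>w1\<close> and \<open>w2\<close> removes the
  constant \<open>cnj (h 0)\<close> and leaves a kernel with the factor \<open>w1 - w2\<close>. Its
  denominator has modulus at least \<open>(R / 2) * (R / 2)\<close> because both points lie in the
  disc of half the radius.\<close>

lemma Re_oscillation_le_mean:
  assumes h: "h holomorphic_on cball 0 R" and R: "0 < R"
    and w: "cmod w1 \<le> R / 2" "cmod w2 \<le> R / 2"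
  shows "cmod (h w1 - h w2)
    \<le> 8 * cmod (w1 - w2) / R * (integral {0..2 * pi} (\<lambda>t. \<bar>Re (h (of_real R * exp (\<i> * of_real t)))\<bar>) / (2 * pi))"
proof -
  let ?c = "\<lambda>t. of_real R * exp (\<i> * of_real t) :: complex"
  let ?u = "\<lambda>t. Re (h (?c t))"
  have w': "cmod w1 < R" "cmod w2 < R" using w R by auto
  have ne: "?c t \<noteq> w1" "?c t \<noteq> w2" for t
  proof -
    have "cmod (?c t) = R" using R by (simp add: norm_mult)
    with w' show "?c t \<noteq> w1" "?c t \<noteq> w2" by auto
  qed
  have "((\<lambda>t. of_real (?u t) * ?c t / (?c t - w1) - of_real (?u t) * ?c t / (?c t - w2)) has_integral
      of_real pi * (h w1 + cnj (h 0)) - of_real pi * (h w2 + cnj (h 0))) {0..2 * pi}"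
    by (intro has_integral_diff Schwarz_integral_circle h w')
  moreover have "of_real (?u t) * ?c t / (?c t - w1) - of_real (?u t) * ?c t / (?c t - w2)
      = of_real (?u t) * ?c t * (w1 - w2) / ((?c t - w1) * (?c t - w2))" for t
    using ne[of t] by (simp add: divide_simps) (simp add: algebra_simps)
  ultimately have I: "((\<lambda>t. of_real (?u t) * ?c t * (w1 - w2) / ((?c t - w1) * (?c t - w2))) has_integral
      of_real pi * (h w1 - h w2)) {0..2 * pi}" (is "(?F has_integral _) _")
    by (simp add: algebra_simps)
  have cont: "continuous_on {0..2 * pi} (\<lambda>t. h (?c t))"
    by (rule continuous_on_compose2[OF holomorphic_on_imp_continuous_on[OF h]])
       (use R in \<open>auto intro!: continuous_intros simp: norm_mult\<close>)
  have int: "(\<lambda>t. \<bar>?u t\<bar>) integrable_on {0..2 * pi}"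
    by (intro integrable_continuous_interval continuous_intros cont)
  have "norm (integral {0..2 * pi} ?F) \<le> integral {0..2 * pi} (\<lambda>t. 4 * cmod (w1 - w2) / R * \<bar>?u t\<bar>)"
  proof (rule integral_norm_bound_integral)
    show "?F integrable_on {0..2 * pi}" using I by blast
    show "(\<lambda>t. 4 * cmod (w1 - w2) / R * \<bar>?u t\<bar>) integrable_on {0..2 * pi}"
      by (rule integrable_on_cmult_left[OF int, simplified])
    fix t
    have c: "cmod (?c t) = R" using R by (simp add: norm_mult)
    have "R / 2 \<le> cmod (?c t - w1)" "R / 2 \<le> cmod (?c t - w2)"
      using norm_triangle_ineq2[of "?c t" w1] norm_triangle_ineq2[of "?c t" w2] w c by linarith+
    then have "(R / 2) * (R / 2) \<le> cmod (?c t - w1) * cmod (?c t - w2)"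
      using R by (intro mult_mono) auto
    then have "cmod (?F t) \<le> \<bar>?u t\<bar> * R * cmod (w1 - w2) / ((R / 2) * (R / 2))"
      unfolding norm_divide norm_mult using R c by (intro divide_left_mono frac_le mult_pos_pos) (auto simp: norm_mult)
    also have "\<dots> = 4 * cmod (w1 - w2) / R * \<bar>?u t\<bar>"
      using R by (simp add: field_simps)
    finally show "norm (?F t) \<le> 4 * cmod (w1 - w2) / R * \<bar>?u t\<bar>" .
  qed
  moreover have "norm (integral {0..2 * pi} ?F) = pi * cmod (h w1 - h w2)"
    using integral_unique[OF I] by (simp add: norm_mult)
  ultimately have "pi * cmod (h w1 - h w2) \<le> 4 * cmod (w1 - w2) / R * integral {0..2 * pi} (\<lambda>t. \<bar>?u t\<bar>)"
    by simp
  then have "cmod (h w1 - h w2) \<le> 4 * cmod (w1 - w2) / R * integral {0..2 * pi} (\<lambda>t. \<bar>?u t\<bar>) / pi"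
    by (subst pos_le_divide_eq) (auto simp: mult.commute)
  then show ?thesis by simp
qed

subsection \<open>Blaschke factorization of a meromorphic function on a disc\<close>

text \<open>
  The origin is always included, whether or not it is a zero or a pole, so that its Blaschke factor
  \<open>z / R\<close> can be split off uniformly in Jensen's formula.
\<close>

definition critical_set :: "(complex \<Rightarrow> complex) \<Rightarrow> complex set" where
  "critical_set f = insert 0 {z. \<not> f analytic_on {z} \<or> f z = 0}"

definition blaschke :: "real \<Rightarrow> complex \<Rightarrow> complex \<Rightarrow> complex" where
  "blaschke R p z = of_real R * (z - p) / ((of_real R)\<^sup>2 - cnj p * z)"

lemma meromorphic_eventually_nonzero:
  assumes "f meromorphic_on UNIV" "\<not> (\<forall>\<^sub>\<approx>z\<in>UNIV. f z = 0)"
  shows "\<forall>\<^sub>\<approx>z\<in>UNIV. f z \<noteq> 0" "\<forall>\<^sub>F z in at w. f z \<noteq> 0"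
proof -
  show *: "\<forall>\<^sub>\<approx>z\<in>UNIV. f z \<noteq> 0"
    using meromorphic_imp_constant_or_avoid[OF assms(1), of 0] assms(2) by auto
  show "\<forall>\<^sub>F z in at w. f z \<noteq> 0"
    using eventually_cosparse_imp_eventually_at[OF *] by simp
qed

lemma critical_set_sparse:
  assumes "f meromorphic_on UNIV" "\<not> (\<forall>\<^sub>\<approx>z\<in>UNIV. f z = 0)"
  shows "critical_set f sparse_in UNIV"
proof -
  have "{z. \<not> f analytic_on {z}} sparse_in UNIV"
    by (rule meromorphic_on_imp_sparse_singularities[OF assms(1)])
  moreover have "{z. f z = 0} sparse_in UNIV"
    using meromorphic_eventually_nonzero(1)[OF assms] by (simp add: eventually_cosparse)
  moreover have "critical_set f = {0} \<union> ({z. \<not> f analytic_on {z}} \<union> {z. f z = 0})"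
    by (auto simp: critical_set_def)
  ultimately show ?thesis
    by (simp only:) (intro sparse_in_union' sparse_in_singleton)
qed

lemma finite_critical_set_Int_cball:
  assumes "f meromorphic_on UNIV" "\<not> (\<forall>\<^sub>\<approx>z\<in>UNIV. f z = 0)"
  shows "finite (critical_set f \<inter> cball 0 R)"
  using sparse_in_compact_finite[OF sparse_in_subset[OF critical_set_sparse[OF assms]], of "cball 0 R"]
  by (simp add: Int_commute)

text \<open>Order \<open>0\<close> excludes a pole, so a finite limit exists; the limit
  \<open>0\<close> would make \<open>z\<close> an isolated zero, whose order is positive.\<close>

lemma remove_sings_analytic_nonzero:
  assumes f: "f meromorphic_on {z}" and ev: "\<forall>\<^sub>F w in at z. f w \<noteq> 0" and ord: "zorder f z = 0"
  shows "remove_sings f analytic_on {z}" "remove_sings f z \<noteq> 0"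
proof -
  have iso: "isolated_singularity_at f z" and ne: "not_essential f z"
    using f by (auto simp: meromorphic_at_iff)
  have "\<not> is_pole f z"
    using isolated_pole_imp_neg_zorder[OF iso] ord by auto
  then obtain c where c: "f \<midarrow>z\<rightarrow> c"
    using ne by (auto simp: not_essential_def)
  show "remove_sings f analytic_on {z}"
    by (rule remove_sings_analytic_at[OF iso c])
  have "c \<noteq> 0"
    using zorder_isolated_zero_pos'[OF _ iso] c ev ord by (auto simp: isolated_zero_def)
  then show "remove_sings f z \<noteq> 0"
    using remove_sings_eqI[OF c] by simp
qed

text \<open>On the circle \<open>(of_real R)\<^sup>2 = z * cnj z\<close>, so the denominator is
  \<open>z * cnj (z - p)\<close>, of modulus \<open>R * cmod (z - p)\<close>.\<close>

lemma norm_blaschke_circle: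
  assumes "cmod p < R" "cmod z = R"
  shows "cmod (blaschke R p z) = 1"
proof -
  have R: "0 < R" using assms(1) by (smt (verit) norm_ge_zero)
  have ne: "z \<noteq> p" using assms by auto
  have sq: "(of_real R)\<^sup>2 = z * cnj z" using complex_norm_square[of z] assms(2) by simp
  have "(of_real R)\<^sup>2 - cnj p * z = z * cnj (z - p)"
    by (simp add: sq algebra_simps)
  then have "cmod (blaschke R p z) = R * cmod (z - p) / (cmod z * cmod (z - p))"
    using R by (simp add: blaschke_def norm_mult norm_divide flip: complex_cnj_diff)
  then show ?thesis using R ne assms(2) by simp
qed

lemma blaschke_eq_0_iff:
  assumes "cmod p < R" "cmod z \<le> R"
  shows "blaschke R p z = 0 \<longleftrightarrow> z = p"
proof -
  have "0 < R" using assms(1) by (smt (verit) norm_ge_zero)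
  then show ?thesis
    using radius_square_neq_cnj_mult[OF assms] by (simp add: blaschke_def)
qed

lemma zorder_blaschke_power_int:
  assumes "cmod p < R" "cmod q \<le> R"
  shows "zorder (\<lambda>z. blaschke R p z powi k) q = (if p = q then k else 0)"
proof -
  let ?S = "{z. (of_real R)\<^sup>2 - cnj p * z \<noteq> 0}"
  have op: "open ?S" by (intro open_Collect_neq continuous_intros)
  have q: "q \<in> ?S" using radius_square_neq_cnj_mult[OF assms] by simp
  have R: "0 < R" using assms(1) by (smt (verit) norm_ge_zero)
  show ?thesis
  proof (cases "p = q")
    case True
    have "zorder (\<lambda>z. blaschke R p z powi k) q = k"
    proof (rule zorder_eqI[OF op q])
      show "(\<lambda>z. (of_real R / ((of_real R)\<^sup>2 - cnj p * z)) powi k) holomorphic_on ?S"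
        using R by (intro holomorphic_intros) auto
      show "(of_real R / ((of_real R)\<^sup>2 - cnj p * q)) powi k \<noteq> 0"
        using R q by simp
      show "blaschke R p w powi k = (of_real R / ((of_real R)\<^sup>2 - cnj p * w)) powi k * (w - q) powi k" for w
        by (simp add: True blaschke_def flip: power_int_mult_distrib)
    qed
    then show ?thesis using True by simp
  next
    case False
    have "zorder (\<lambda>z. blaschke R p z powi k) q = 0"
    proof (rule zorder_eqI)
      show "open (?S - {p})" using op by auto
      show "q \<in> ?S - {p}" using q False by auto
      show "(\<lambda>z. blaschke R p z powi k) holomorphic_on ?S - {p}"
        using R unfolding blaschke_def by (intro holomorphic_intros) auto
      show "blaschke R p q powi k \<noteq> 0"
        using blaschke_eq_0_iff[OF assms] False by simp
    qed simp
    then show ?thesis using False by simp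
  qed
qed

lemma eventually_blaschke_nonzero:
  assumes "cmod p < R" "cmod q \<le> R"
  shows "\<forall>\<^sub>F z in at q. blaschke R p z \<noteq> 0"
proof -
  have R: "0 < R" using assms(1) by (smt (verit) norm_ge_zero)
  have "(\<lambda>z. (of_real R)\<^sup>2 - cnj p * z) \<midarrow>q\<rightarrow> (of_real R)\<^sup>2 - cnj p * q"
    by (intro tendsto_intros)
  then have "\<forall>\<^sub>F z in at q. (of_real R)\<^sup>2 - cnj p * z \<noteq> 0"
    by (rule tendsto_imp_eventually_ne) (rule radius_square_neq_cnj_mult[OF assms])
  moreover have "\<forall>\<^sub>F z in at q. z \<noteq> p"
    using eventually_neq_at_within by blast
  ultimately show ?thesis
    by eventually_elim (use R in \<open>simp add: blaschke_def\<close>)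
qed

text \<open>Dividing \<open>f\<close> by its Blaschke factors leaves a function of order
  \<open>0\<close> at every point of the closed disc. With the removable singularities filled in it
  is analytic and zero-free there, hence also on a slightly larger disc, where it has a holomorphic
  logarithm. A circle without critical points ensures that each factor is centred strictly
  inside.\<close>

lemma meromorphic_Blaschke_factorization:
  assumes f: "f meromorphic_on UNIV" "\<not> (\<forall>\<^sub>\<approx>z\<in>UNIV. f z = 0)"
    and D: "D = critical_set f \<inter> cball 0 R" and circ: "critical_set f \<inter> sphere 0 R = {}" and R: "0 < R"
  obtains h where "h holomorphic_on cball 0 R"
    "\<And>z. z \<in> cball 0 R - D \<Longrightarrow> f z = exp (h z) * (\<Prod>p\<in>D. blaschke R p z powi zorder f p)"
proof -
  have fin: "finite D" unfolding D by (rule finite_critical_set_Int_cball[OF f])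
  have DR: "cmod p < R" if "p \<in> D" for p
    using that circ unfolding D by (force simp: order.order_iff_strict)
  define Q where "Q z = (\<Prod>p\<in>D. blaschke R p z powi - zorder f p)" for z
  define E where "E z = f z * Q z" for z
  define F where "F = remove_sings E"
  have mB: "(\<lambda>z. blaschke R p z powi k) meromorphic_on A" for p k A
    unfolding blaschke_def by (intro meromorphic_intros)
  have mQ: "Q meromorphic_on A" for A unfolding Q_def by (intro meromorphic_on_prod mB)
  have mf: "f meromorphic_on A" for A using f(1) by (rule meromorphic_on_subset) simp
  have mE: "E meromorphic_on A" for A unfolding E_def by (intro meromorphic_intros mf mQ)
  have evQ: "\<forall>\<^sub>F z in at q. Q z \<noteq> 0" if "q \<in> cball 0 R" for q
  proof -
    have "\<forall>\<^sub>F z in at q. \<forall>p\<in>D. blaschke R p z \<noteq> 0"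
      using that by (intro eventually_ball_finite[OF fin] ballI eventually_blaschke_nonzero DR) auto
    then show ?thesis
      by eventually_elim (use fin in \<open>simp add: Q_def\<close>)
  qed
  have evf: "\<forall>\<^sub>F z in at q. f z \<noteq> 0" for q by (rule meromorphic_eventually_nonzero(2)[OF f])
  have evE: "\<forall>\<^sub>F z in at q. E z \<noteq> 0" if "q \<in> cball 0 R" for q
    using evf evQ[OF that] by eventually_elim (simp add: E_def)
  have ordE: "zorder E q = 0" if q: "q \<in> cball 0 R" for q
  proof -
    have "zorder Q q = (\<Sum>p\<in>D. zorder (\<lambda>z. blaschke R p z powi - zorder f p) q)"
      unfolding Q_def by (rule zorder_prod[OF mB]) (use evQ[OF q] in \<open>simp add: Q_def\<close>)
    also have "\<dots> = (\<Sum>p\<in>D. if p = q then - zorder f p else 0)"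
      using q by (intro sum.cong refl zorder_blaschke_power_int DR) auto
    also have "\<dots> = (if q \<in> D then - zorder f q else 0)"
      using fin by simp
    finally have Qq: "zorder Q q = (if q \<in> D then - zorder f q else 0)" .
    have "zorder E q = zorder f q + zorder Q q"
      unfolding E_def
      by (rule zorder_mult) (use evf evQ[OF q] mf mQ in \<open>auto intro!: eventually_frequently\<close>)
    moreover have "zorder f q = 0" if "q \<notin> D"
      using that q by (intro zorder_eq_0I) (auto simp: D critical_set_def)
    ultimately show ?thesis using Qq by auto
  qed
  have F: "F analytic_on {q}" "F q \<noteq> 0" if "q \<in> cball 0 R" for q
    using remove_sings_analytic_nonzero[OF mE evE[OF that] ordE[OF that]] by (auto simp: F_def)
  have "F analytic_on cball 0 R"
    using F(1) analytic_on_analytic_at by blast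
  then obtain U where U: "open U" "cball 0 R \<subseteq> U" "F holomorphic_on U"
    using analytic_on_holomorphic by auto
  have "open (U - F -` {0})"
    using continuous_open_preimage[OF holomorphic_on_imp_continuous_on[OF U(3)] U(1), of "-{0}"]
    by (simp add: open_Compl vimage_Compl Diff_eq)
  moreover have "cball 0 R \<subseteq> U - F -` {0}" using U(2) F(2) by auto
  ultimately obtain e where e: "e > 0" "(\<Union>x\<in>cball 0 R. ball x e) \<subseteq> U - F -` {0}"
    using compact_subset_open_imp_ball_epsilon_subset[of "cball 0 R" "U - F -` {0}"] by auto
  \<comment> \<open>Compactness gives a uniform margin \<open>e\<close> around the closed disc. A
    point outside the disc is compared with its radial projection \<open>?x\<close> to the
    circle.\<close>
  have sub: "ball 0 (R + e) \<subseteq> U - F -` {0}"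
  proof
    fix z :: complex assume z: "z \<in> ball 0 (R + e)"
    show "z \<in> U - F -` {0}"
    proof (cases "cmod z \<le> R")
      case True then show ?thesis using e by force
    next
      case False
      let ?x = "of_real (R / cmod z) * z"
      have nz: "cmod z > 0" using False R by linarith
      have "cmod ?x = R" using nz R by (simp add: norm_mult norm_divide)
      moreover have "dist ?x z < e"
      proof -
        have "?x - z = of_real (R / cmod z - 1) * z" by (simp add: algebra_simps)
        then have "dist ?x z = \<bar>R / cmod z - 1\<bar> * cmod z"
          by (simp only: dist_norm norm_mult norm_of_real)
        also have "\<dots> = cmod z - R" using nz False by (simp add: abs_if field_simps)
        finally show ?thesis using z by simp
      qed
      ultimately show ?thesis using e(2) by (force simp: mem_ball)
    qed
  qed
  obtain h where h: "h holomorphic_on ball 0 (R + e)" "\<And>x. x \<in> ball 0 (R + e) \<Longrightarrow> exp (h x) = F x"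
    by (rule holomorphic_logarithm_exists[of "ball 0 (R + e)" F 0])
       (use sub U(3) R e in \<open>auto intro: holomorphic_on_subset\<close>)
  show ?thesis
  proof
    show "h holomorphic_on cball 0 R"
      by (rule holomorphic_on_subset[OF h(1)]) (use e in auto)
    fix z assume z: "z \<in> cball 0 R - D"
    have bn: "blaschke R p z \<noteq> 0" if "p \<in> D" for p
      using blaschke_eq_0_iff[OF DR[OF that], of z] z that by auto
    have "blaschke R p analytic_on {z}" if "p \<in> D" for p
      unfolding blaschke_def by (intro analytic_intros) (use radius_square_neq_cnj_mult[OF DR[OF that], of z] z in auto)
    \<comment> \<open>Off \<open>D\<close> the product \<open>E\<close> is already analytic, so
      removing singularities does not change its value there.\<close>
    then have "Q analytic_on {z}"
      unfolding Q_def using bn by (intro analytic_intros) auto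
    moreover have "f analytic_on {z}" using z by (auto simp: D critical_set_def)
    ultimately have "E analytic_on {z}" unfolding E_def by (intro analytic_intros)
    then have "F z = E z" by (simp add: F_def)
    then have "exp (h z) = f z * Q z"
      using h(2)[of z] z e by (simp add: E_def)
    moreover have "Q z * (\<Prod>p\<in>D. blaschke R p z powi zorder f p) = 1"
      unfolding Q_def prod.distrib[symmetric]
      by (intro prod.neutral ballI) (use bn in \<open>simp flip: power_int_add\<close>)
    ultimately show "f z = exp (h z) * (\<Prod>p\<in>D. blaschke R p z powi zorder f p)"
      by (simp add: mult.assoc)
  qed
qed

subsection \<open>Averages of sums of power singularities\<close>

text \<open>For \<open>t \<le> 1\<close> compare both sides with \<open>t\<close>; for
  \<open>t > 1\<close> use \<open>1 + t \<le> 2 * t\<close> and \<open>ln y \<le> y - 1\<close> at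
  \<open>y = t powr a\<close>. With \<open>t = n / \<bar>x - c\<bar>\<close> and
  \<open>a < 1\<close> it replaces a logarithmic singularity by an integrable power.\<close>

lemma ln_one_plus_le_powr:
  fixes t a :: real
  assumes "0 \<le> t" "0 < a" "a \<le> 1"
  shows "ln (1 + t) \<le> t powr a / a"
proof (cases "t \<le> 1")
  case True
  have "ln (1 + t) \<le> t" using ln_add_one_self_le_self assms(1) by simp
  also have "t \<le> t powr a"
  proof (cases "t = 0")
    case False
    then have "t powr 1 \<le> t powr a" using True assms by (intro powr_mono') auto
    then show ?thesis using assms False by simp
  qed simp
  also have "\<dots> \<le> t powr a / a"
    using assms by (simp add: pos_le_divide_eq mult_left_le)
  finally show ?thesis .
next
  case False
  have "ln (1 + t) \<le> ln (2 * t)" using False by (subst ln_le_cancel_iff) auto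
  also have "\<dots> = ln 2 + ln t" using False by (simp add: ln_mult)
  also have "\<dots> \<le> 1 + ln (t powr a) / a"
    using False assms ln_2_less_1 by (simp add: ln_powr)
  also have "\<dots> \<le> 1 / a + (t powr a - 1) / a"
    using False assms ln_le_minus_one[of "t powr a"]
    by (intro add_mono divide_right_mono) auto
  also have "\<dots> = t powr a / a" by (simp add: diff_divide_distrib)
  finally show ?thesis .
qed

text \<open>The antiderivative \<open>sgn (x - c) * \<bar>x - c\<bar> powr e / e\<close> is
  continuous across \<open>c\<close>, so the fundamental theorem applies with \<open>c\<close> as
  the only exceptional point.\<close>

lemma has_integral_powr_abs_diff:
  fixes a b c e :: real
  assumes "a \<le> b" "0 < e"
  shows "((\<lambda>x. \<bar>x - c\<bar> powr (e - 1)) has_integral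
     (sgn (b - c) * \<bar>b - c\<bar> powr e / e - sgn (a - c) * \<bar>a - c\<bar> powr e / e)) {a..b}"
proof (rule fundamental_theorem_of_calculus_interior_strong[where S = "{c}"])
  show "finite {c}" "a \<le> b" using assms by auto
  show "continuous_on {a..b} (\<lambda>x. sgn (x - c) * \<bar>x - c\<bar> powr e / e)"
  proof -
    have eq: "sgn (x - c) * \<bar>x - c\<bar> powr e / e = (max 0 (x - c) powr e - max 0 (c - x) powr e) / e" for x
      by (auto simp: sgn_if max_def)
    show ?thesis
      unfolding eq using assms by (intro continuous_intros continuous_on_powr') auto
  qed
  show "((\<lambda>x. sgn (x - c) * \<bar>x - c\<bar> powr e / e) has_vector_derivative \<bar>x - c\<bar> powr (e - 1)) (at x)"
    if x: "x \<in> {a<..<b} - {c}" for x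
  proof (cases "x > c")
    case True
    have "((\<lambda>x. (x - c) powr e / e) has_real_derivative \<bar>x - c\<bar> powr (e - 1)) (at x)"
      using True assms by (auto intro!: derivative_eq_intros simp: powr_diff)
    then have "((\<lambda>x. sgn (x - c) * \<bar>x - c\<bar> powr e / e) has_real_derivative \<bar>x - c\<bar> powr (e - 1)) (at x)"
      by (rule has_field_derivative_transform_within_open[of _ _ _ "{c<..}"]) (use True in auto)
    then show ?thesis by (simp add: has_real_derivative_iff_has_vector_derivative)
  next
    case False
    then have "x < c" using x by auto
    have "((\<lambda>x. - ((c - x) powr e) / e) has_real_derivative \<bar>x - c\<bar> powr (e - 1)) (at x)"
      using \<open>x < c\<close> assms by (auto intro!: derivative_eq_intros simp: powr_diff)
    then have "((\<lambda>x. sgn (x - c) * \<bar>x - c\<bar> powr e / e) has_real_derivative \<bar>x - c\<bar> powr (e - 1)) (at x)"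
      by (rule has_field_derivative_transform_within_open[of _ _ _ "{..<c}"]) (use \<open>x < c\<close> in auto)
    then show ?thesis by (simp add: has_real_derivative_iff_has_vector_derivative)
  qed
qed

text \<open>An averaging argument: each singularity contributes at most
  \<open>2 * K powr e / e\<close> to the integral over \<open>{a..b}\<close>, so the sum cannot
  exceed the stated value at every point off a finite set. The extra \<open>1\<close> turns the weak
  inequality between the integrals into a contradiction.\<close>

lemma exists_small_singular_sum:
  fixes c m :: "'i \<Rightarrow> real"
  assumes I: "finite I" and m: "\<And>i. i \<in> I \<Longrightarrow> 0 \<le> m i" and ab: "a < b" and e: "0 < e"
    and K: "\<And>i. i \<in> I \<Longrightarrow> \<bar>a - c i\<bar> \<le> K" "\<And>i. i \<in> I \<Longrightarrow> \<bar>b - c i\<bar> \<le> K"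
    and F: "finite F"
  shows "\<exists>x\<in>{a..b} - F. (\<Sum>i\<in>I. m i * \<bar>x - c i\<bar> powr (e - 1))
            \<le> ((\<Sum>i\<in>I. m i) * (2 * K powr e / e) + 1) / (b - a)"
proof (rule ccontr)
  let ?g = "\<lambda>x. \<Sum>i\<in>I. m i * \<bar>x - c i\<bar> powr (e - 1)"
  let ?V = "((\<Sum>i\<in>I. m i) * (2 * K powr e / e) + 1) / (b - a)"
  let ?J = "\<lambda>i. sgn (b - c i) * \<bar>b - c i\<bar> powr e / e - sgn (a - c i) * \<bar>a - c i\<bar> powr e / e"
  assume "\<not> (\<exists>x\<in>{a..b} - F. ?g x \<le> ?V)"
  then have gt: "?V < ?g x" if "x \<in> {a..b} - F" for x using that by force
  have int: "(?g has_integral (\<Sum>i\<in>I. m i * ?J i)) {a..b}"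
    by (intro has_integral_sum I has_integral_mult_right has_integral_powr_abs_diff e) (use ab in auto)
  have "((\<lambda>x. ?V) has_integral ?V * (b - a)) {a..b}"
    using has_integral_const_real[of ?V a b] ab by (simp add: mult.commute)
  \<comment> \<open>On the finite set \<open>F\<close> the constant is replaced by the sum itself,
    so that the comparison holds at every point of the interval without changing the
    integral.\<close>
  then have "((\<lambda>x. if x \<in> F then ?g x else ?V) has_integral ?V * (b - a)) {a..b}"
    by (rule has_integral_spike_finite[OF F, rotated]) simp
  then have "?V * (b - a) \<le> (\<Sum>i\<in>I. m i * ?J i)"
    by (rule has_integral_le[OF _ int]) (use gt in \<open>auto intro: less_imp_le\<close>)
  also have "\<dots> \<le> (\<Sum>i\<in>I. m i * (2 * K powr e / e))"
  proof (intro sum_mono mult_left_mono m)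
    fix i assume i: "i \<in> I"
    have *: "\<bar>sgn x * \<bar>x\<bar> powr e / e\<bar> \<le> K powr e / e" if "\<bar>x\<bar> \<le> K" for x
      using that e by (auto simp: abs_mult abs_sgn_eq intro!: divide_right_mono powr_mono2)
    show "?J i \<le> 2 * K powr e / e"
      using *[OF K(1)[OF i]] *[OF K(2)[OF i]] unfolding times_divide_eq_right[symmetric] by linarith
  qed
  also have "\<dots> = (\<Sum>i\<in>I. m i) * (2 * K powr e / e)" by (rule sum_distrib_right[symmetric])
  finally show False using ab by simp
qed

subsection \<open>Jensen's formula and the Nevanlinna characteristic\<close>

lemma ln_power_int: "0 < x \<Longrightarrow> ln (x powi k) = of_int k * ln x" for x :: real
  by (simp add: ln_powr flip: powr_real_of_int')

lemma pole_in_critical_set: "is_pole f z \<Longrightarrow> z \<in> critical_set f"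
  using analytic_at_imp_no_pole by (auto simp: critical_set_def)

text \<open>All poles are critical points, and at a critical point that is not a pole the order is
  nonnegative, so \<open>nat\<close> turns its term into \<open>0\<close>. The index set is thus cut
  out of one finite set for all \<open>t \<le> R\<close>.\<close>

lemma pole_count_eq:
  assumes f: "f meromorphic_on UNIV" "\<not> (\<forall>\<^sub>\<approx>z\<in>UNIV. f z = 0)" and t: "t \<le> R"
  shows "pole_count f t = (\<Sum>p\<in>{p \<in> critical_set f \<inter> cball 0 R. cmod p \<le> t}. nat (- zorder f p))"
  unfolding pole_count_def
proof (rule sum.mono_neutral_left)
  show "finite {p \<in> critical_set f \<inter> cball 0 R. cmod p \<le> t}"
    by (rule finite_subset[OF _ finite_critical_set_Int_cball[OF f]]) auto
  show "{z. cmod z \<le> t \<and> is_pole f z} \<subseteq> {p \<in> critical_set f \<inter> cball 0 R. cmod p \<le> t}"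
    using t pole_in_critical_set by auto
  have nn: "\<not> zorder f p < 0" if "\<not> is_pole f p" for p
    using that zorder_neg_imp_is_pole[of f p] f(1) meromorphic_eventually_nonzero(2)[OF f]
      meromorphic_on_subset by blast
  show "\<forall>p\<in>{p \<in> critical_set f \<inter> cball 0 R. cmod p \<le> t} - {z. cmod z \<le> t \<and> is_pole f z}.
      nat (- zorder f p) = 0"
  proof
    fix p assume "p \<in> {p \<in> critical_set f \<inter> cball 0 R. cmod p \<le> t} - {z. cmod z \<le> t \<and> is_pole f z}"
    then have "\<not> is_pole f p" by auto
    from nn[OF this] show "nat (- zorder f p) = 0" by simp
  qed
qed

text \<open>A pole \<open>p \<noteq> 0\<close> is counted for \<open>t\<close> from
  \<open>cmod p\<close> to \<open>R\<close>, and the integral of \<open>1 / t\<close> over this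
  range is \<open>ln (R / cmod p)\<close>. A pole at the origin only enters through the term with
  \<open>ln R\<close>.\<close>

lemma integrated_pole_count_eq:
  assumes f: "f meromorphic_on UNIV" "\<not> (\<forall>\<^sub>\<approx>z\<in>UNIV. f z = 0)" and R: "0 < R"
    and D: "D = critical_set f \<inter> cball 0 R"
  shows "integrated_pole_count f R = (\<Sum>p\<in>D - {0}. real (nat (- zorder f p)) * ln (R / cmod p))
           + real (nat (- zorder f 0)) * ln R"
proof -
  let ?m = "\<lambda>p. real (nat (- zorder f p))"
  have fin: "finite D" unfolding D by (rule finite_critical_set_Int_cball[OF f])
  have zD: "0 \<in> D" using R by (simp add: D critical_set_def)
  have n: "real (pole_count f t) = (\<Sum>p\<in>D - {0}. if cmod p \<le> t then ?m p else 0) + ?m 0"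
    if t: "0 \<le> t" "t \<le> R" for t
  proof -
    have "real (pole_count f t) = (\<Sum>p\<in>{p \<in> D. cmod p \<le> t}. ?m p)"
      using pole_count_eq[OF f t(2)] by (simp add: D)
    also have "\<dots> = (\<Sum>p\<in>D. if cmod p \<le> t then ?m p else 0)"
      by (rule sum.inter_filter[OF fin])
    finally show ?thesis
      using sum.remove[OF fin zD, of "\<lambda>p. if cmod p \<le> t then ?m p else 0"] t by (simp add: add.commute)
  qed
  have n0: "real (pole_count f 0) = ?m 0"
    using n[of 0] R by (simp add: sum.neutral)
  have "((\<lambda>t. \<Sum>p\<in>D - {0}. ?m p * (if t \<in> {cmod p..R} then 1 / t else 0)) has_integral
      (\<Sum>p\<in>D - {0}. ?m p * ln (R / cmod p))) {0..R}"
  proof (intro has_integral_sum has_integral_mult_right)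
    fix p assume p: "p \<in> D - {0}"
    then have p': "0 < cmod p" "cmod p \<le> R" by (auto simp: D)
    have "((\<lambda>t. 1 / t) has_integral ln R - ln (cmod p)) {cmod p..R}"
    proof (rule fundamental_theorem_of_calculus)
      show "(ln has_vector_derivative 1 / t) (at t within {cmod p..R})" if "t \<in> {cmod p..R}" for t
      proof -
        have "0 < t" using less_le_trans[OF p'(1)] that by simp
        then show ?thesis
          using DERIV_ln_divide[of t]
          by (auto intro: has_field_derivative_at_within simp flip: has_real_derivative_iff_has_vector_derivative)
      qed
    qed (use p' in auto)
    then show "((\<lambda>t. if t \<in> {cmod p..R} then 1 / t else 0) has_integral ln (R / cmod p)) {0..R}"
      using p' R by (subst has_integral_restrict) (auto simp: ln_div)
  qed (use fin in auto)
  moreover have "(\<Sum>p\<in>D - {0}. ?m p * (if t \<in> {cmod p..R} then 1 / t else 0))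
      = (real (pole_count f t) - real (pole_count f 0)) / t" if "t \<in> {0..R}" for t
    using that unfolding n0 by (subst n) (auto simp: sum_divide_distrib intro!: sum.cong split: if_splits)
  ultimately have "((\<lambda>t. (real (pole_count f t) - real (pole_count f 0)) / t) has_integral
      (\<Sum>p\<in>D - {0}. ?m p * ln (R / cmod p))) {0..R}"
    by (rule has_integral_eq[rotated])
  then show ?thesis
    unfolding integrated_pole_count_def n0 by (simp add: integral_unique)
qed

text \<open>Cancel the power of \<open>z\<close> in the factorization, evaluate at the origin and
  take logarithms, using \<open>cmod (blaschke R p 0) = cmod p / R\<close>. The number
  \<open>zor_poly f 0 0\<close> is the leading Laurent coefficient of \<open>f\<close> at
  \<open>0\<close>.\<close>

lemma Jensen_formula:
  assumes f: "f meromorphic_on UNIV" "\<not> (\<forall>\<^sub>\<approx>z\<in>UNIV. f z = 0)"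
    and D: "D = critical_set f \<inter> cball 0 R" and circ: "critical_set f \<inter> sphere 0 R = {}" and R: "0 < R"
    and h: "h holomorphic_on cball 0 R"
    and fact: "\<And>z. z \<in> cball 0 R - D \<Longrightarrow> f z = exp (h z) * (\<Prod>p\<in>D. blaschke R p z powi zorder f p)"
  shows "Re (h 0) = ln (cmod (zor_poly f 0 0)) + of_int (zorder f 0) * ln R
           + (\<Sum>p\<in>D - {0}. of_int (zorder f p) * ln (R / cmod p))"
proof -
  let ?g = "zor_poly f 0" and ?k = "zorder f"
  have fin: "finite D" unfolding D by (rule finite_critical_set_Int_cball[OF f])
  have DR: "cmod p < R" if "p \<in> D" for p
    using that circ unfolding D by (force simp: order.order_iff_strict)
  have zD: "0 \<in> D" using R by (simp add: D critical_set_def)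
  have "isolated_singularity_at f 0" "not_essential f 0"
    using f(1) by (auto simp: meromorphic_on_altdef)
  then obtain r where r: "r > 0" "?g holomorphic_on cball 0 r"
      "\<And>w. w \<in> cball 0 r - {0} \<Longrightarrow> f w = ?g w * w powi ?k 0" and g0: "?g 0 \<noteq> 0"
    using zorder_exist[of f 0] eventually_frequently[OF _ meromorphic_eventually_nonzero(2)[OF f, of 0]]
    by auto
  \<comment> \<open>\<open>G\<close> is the factorization divided by \<open>z powi ?k 0\<close>; the
    factor at the origin is \<open>z / R\<close>, which leaves \<open>R powi - ?k 0\<close>. Since
    \<open>G\<close> and \<open>?g\<close> agree near \<open>0\<close> and are continuous there,
    their values at \<open>0\<close> agree.\<close>
  define G where "G z = exp (h z) * (of_real R powi - ?k 0 * (\<Prod>p\<in>D - {0}. blaschke R p z powi ?k p))" for z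
  have evG: "\<forall>\<^sub>F z in at 0. ?g z = G z"
  proof -
    have "\<forall>\<^sub>F z in at 0. z \<in> ball 0 (min r R) - {0}"
      using r(1) R by (intro eventually_at_in_open) auto
    moreover have "\<forall>\<^sub>F z in at 0. \<forall>p\<in>D. z \<noteq> p"
      using fin by (intro eventually_ball_finite ballI) (auto intro: eventually_neq_at_within)
    ultimately show ?thesis
    proof eventually_elim
      case (elim z)
      then have z: "z \<in> cball 0 R - D" "z \<in> cball 0 r - {0}" "z \<noteq> 0" by auto
      have "?g z * z powi ?k 0 = exp (h z) * (\<Prod>p\<in>D. blaschke R p z powi ?k p)"
        using fact[OF z(1)] r(3)[OF z(2)] by simp
      also have "(\<Prod>p\<in>D. blaschke R p z powi ?k p)
          = blaschke R 0 z powi ?k 0 * (\<Prod>p\<in>D - {0}. blaschke R p z powi ?k p)"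
        by (rule prod.remove[OF fin zD])
      also have "blaschke R 0 z powi ?k 0 = z powi ?k 0 * of_real R powi - ?k 0"
        using R by (simp add: blaschke_def power2_eq_square power_int_divide_distrib power_int_minus field_simps)
      finally have "?g z * z powi ?k 0 = G z * z powi ?k 0"
        by (simp add: G_def)
      then show ?case using z(3) by simp
    qed
  qed
  have "isCont h 0"
    using holomorphic_on_imp_continuous_on[OF h] R continuous_on_interior[of "cball 0 R" h 0] by simp
  moreover have "isCont (blaschke R p) 0" for p
    unfolding blaschke_def using R by (intro continuous_intros) auto
  moreover have b0: "blaschke R p 0 \<noteq> 0" if "p \<in> D - {0}" for p
    using blaschke_eq_0_iff[of p R 0] DR[of p] that R by auto
  ultimately have "isCont G 0"
    unfolding G_def by (intro continuous_intros) auto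
  then have "G \<midarrow>0\<rightarrow> G 0" by (rule isContD)
  moreover have "?g \<midarrow>0\<rightarrow> ?g 0"
    using continuous_on_interior[OF holomorphic_on_imp_continuous_on[OF r(2)], of 0] r(1)
    by (intro isContD) simp
  ultimately have "?g 0 = G 0"
    using tendsto_cong[OF evG] LIM_unique by blast
  then have "ln (cmod (?g 0)) = ln (exp (Re (h 0)) * (R powi - ?k 0 * (\<Prod>p\<in>D - {0}. cmod (blaschke R p 0) powi ?k p)))"
    using R by (simp add: G_def norm_mult norm_exp_eq_Re norm_power_int prod_norm[symmetric])
  also have "\<dots> = Re (h 0) + (ln (R powi - ?k 0) + ln (\<Prod>p\<in>D - {0}. cmod (blaschke R p 0) powi ?k p))"
  proof -
    have "0 < (\<Prod>p\<in>D - {0}. cmod (blaschke R p 0) powi ?k p)"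
      using b0 by (intro prod_pos) simp
    moreover have "0 < R powi - ?k 0" using R by simp
    ultimately show ?thesis by (simp add: ln_mult_pos)
  qed
  also have "ln (\<Prod>p\<in>D - {0}. cmod (blaschke R p 0) powi ?k p) = (\<Sum>p\<in>D - {0}. ln (cmod (blaschke R p 0) powi ?k p))"
    using b0 fin by (intro ln_prod) auto
  also have "\<dots> = (\<Sum>p\<in>D - {0}. - (of_int (?k p) * ln (R / cmod p)))"
  proof (rule sum.cong[OF refl])
    fix p assume p: "p \<in> D - {0}"
    have "cmod (blaschke R p 0) = cmod p / R"
      using R by (simp add: blaschke_def norm_mult norm_divide power2_eq_square)
    then show "ln (cmod (blaschke R p 0) powi ?k p) = - (of_int (?k p) * ln (R / cmod p))"
      using p R by (simp add: ln_div ln_power_int algebra_simps)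
  qed
  also have "ln (R powi - ?k 0) = - (of_int (?k 0) * ln R)"
    using R by (simp add: ln_power_int)
  finally show ?thesis by (simp add: sum_negf)
qed

text \<open>With \<open>u\<close> the boundary values of \<open>Re h\<close>,
  \<open>log_plus (cmod f)\<close> is \<open>max 0 u\<close> on the circle. Hence
  \<open>proximity f R\<close> is the mean of the positive part of \<open>u\<close>,
  \<open>Re (h 0)\<close> is the mean of \<open>u\<close>, and the mean of
  \<open>\<bar>u\<bar>\<close> is \<open>2 * proximity f R - Re (h 0)\<close>. Jensen's formula
  relates \<open>Re (h 0)\<close> to the zeros and poles, with \<open>L\<close> absorbing the
  leading coefficient.\<close>

lemma characteristic_bounds:
  assumes f: "f meromorphic_on UNIV" "\<not> (\<forall>\<^sub>\<approx>z\<in>UNIV. f z = 0)"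
    and D: "D = critical_set f \<inter> cball 0 R" and circ: "critical_set f \<inter> sphere 0 R = {}" and R: "1 \<le> R"
    and h: "h holomorphic_on cball 0 R"
    and fact: "\<And>z. z \<in> cball 0 R - D \<Longrightarrow> f z = exp (h z) * (\<Prod>p\<in>D. blaschke R p z powi zorder f p)"
  defines "L \<equiv> \<bar>ln (cmod (zor_poly f 0 0))\<bar>"
  shows "(\<Sum>p\<in>D - {0}. \<bar>of_int (zorder f p)\<bar> * ln (R / cmod p)) + \<bar>of_int (zorder f 0)\<bar> * ln R
           \<le> 2 * nevanlinna_char f R + L"
    and "integral {0..2 * pi} (\<lambda>t. \<bar>Re (h (of_real R * exp (\<i> * of_real t)))\<bar>) / (2 * pi)
           \<le> 2 * nevanlinna_char f R + L"
    and "0 \<le> 2 * nevanlinna_char f R + L"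
proof -
  let ?c = "\<lambda>t. of_real R * exp (\<i> * of_real t) :: complex"
  let ?u = "\<lambda>t. Re (h (?c t))"
  let ?k = "zorder f" and ?m = "proximity f R"
  have R0: "0 < R" using R by simp
  have DR: "cmod p < R" if "p \<in> D" for p
    using that circ unfolding D by (force simp: order.order_iff_strict)
  have cn: "cmod (?c t) = R" for t using R by (simp add: norm_mult)
  have cont: "continuous_on {0..2 * pi} (\<lambda>t. h (?c t))"
    by (rule continuous_on_compose2[OF holomorphic_on_imp_continuous_on[OF h]])
       (use cn in \<open>auto intro!: continuous_intros simp: norm_mult\<close>)
  have int: "(\<lambda>t. max 0 (?u t)) integrable_on {0..2 * pi}"
    by (intro integrable_continuous_interval continuous_intros cont)
  have lp: "log_plus (cmod (f (?c t))) = max 0 (?u t)" for t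
  proof -
    have "?c t \<notin> D" using DR cn[of t] by force
    then have "cmod (f (?c t)) = exp (?u t)"
      using cn[of t] by (subst fact) (auto simp: norm_mult norm_exp_eq_Re norm_power_int
          norm_blaschke_circle DR prod_norm[symmetric])
    then show ?thesis by (simp add: log_plus_def max_def)
  qed
  have m: "integral {0..2 * pi} (\<lambda>t. max 0 (?u t)) = 2 * pi * ?m"
    unfolding proximity_def lp by simp
  have mv: "(?u has_integral 2 * pi * Re (h 0)) {0..2 * pi}"
    by (rule mean_value_Re[OF h R0])
  have "2 * pi * Re (h 0) \<le> 2 * pi * ?m"
    unfolding m[symmetric] by (rule has_integral_le[OF mv integrable_integral[OF int]]) simp
  then have hm: "Re (h 0) \<le> ?m" by simp
  have "0 \<le> 2 * pi * ?m" unfolding m[symmetric] by (intro integral_nonneg int) auto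
  then have m0: "0 \<le> ?m" by (smt (verit) pi_gt_zero zero_le_mult_iff)
  have "((\<lambda>t. 2 * max 0 (?u t) - ?u t) has_integral 2 * (2 * pi * ?m) - 2 * pi * Re (h 0)) {0..2 * pi}"
    unfolding m[symmetric] by (intro has_integral_diff has_integral_mult_right integrable_integral int mv)
  moreover have "2 * max 0 x - x = \<bar>x\<bar>" for x :: real by auto
  ultimately have "integral {0..2 * pi} (\<lambda>t. \<bar>?u t\<bar>) = 2 * pi * (2 * ?m - Re (h 0))"
    by (simp add: integral_unique algebra_simps)
  then have A: "integral {0..2 * pi} (\<lambda>t. \<bar>?u t\<bar>) / (2 * pi) = 2 * ?m - Re (h 0)" by simp
  \<comment> \<open>The order is split into zero multiplicity \<open>a\<close> and pole multiplicity
    \<open>b\<close>; \<open>Nz\<close> and \<open>Np\<close> are the corresponding integrated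
    counting functions.\<close>
  define a where "a p = real (nat (?k p))" for p
  define b where "b p = real (nat (- ?k p))" for p
  define Nz where "Nz = (\<Sum>p\<in>D - {0}. a p * ln (R / cmod p)) + a 0 * ln R"
  define Np where "Np = (\<Sum>p\<in>D - {0}. b p * ln (R / cmod p)) + b 0 * ln R"
  have T: "nevanlinna_char f R = ?m + Np"
    unfolding nevanlinna_char_def Np_def b_def integrated_pole_count_eq[OF f R0 D] ..
  have lnp: "0 \<le> ln (R / cmod p)" if "p \<in> D - {0}" for p
    using DR[of p] that by (intro ln_ge_zero) auto
  have pos: "0 \<le> Nz" "0 \<le> Np"
    unfolding Nz_def Np_def a_def b_def using R by (auto intro!: add_nonneg_nonneg sum_nonneg mult_nonneg_nonneg lnp)
  have nn: "of_int (?k p) = a p - b p" "\<bar>of_int (?k p)\<bar> = a p + b p" for p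
    unfolding a_def b_def by (cases "?k p \<ge> 0"; simp)+
  have "Re (h 0) = ln (cmod (zor_poly f 0 0)) + (Nz - Np)"
    using Jensen_formula[OF f D circ R0 h fact, unfolded nn(1)]
    by (simp add: Nz_def Np_def sum_subtractf left_diff_distrib)
  then have J: "Re (h 0) - L \<le> Nz - Np" "Nz - Np \<le> Re (h 0) + L" unfolding L_def by linarith+
  show "integral {0..2 * pi} (\<lambda>t. \<bar>?u t\<bar>) / (2 * pi) \<le> 2 * nevanlinna_char f R + L"
  proof -
    have "- Re (h 0) \<le> Np + L" using J(2) pos(1) by linarith
    also have "\<dots> \<le> 2 * Np + L" using pos(2) by simp
    finally show ?thesis unfolding A T by simp
  qed
  show "0 \<le> 2 * nevanlinna_char f R + L"
    unfolding T L_def using m0 pos by simp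
  have "(\<Sum>p\<in>D - {0}. \<bar>of_int (?k p)\<bar> * ln (R / cmod p)) + \<bar>of_int (?k 0)\<bar> * ln R = Nz + Np"
    unfolding nn(2) Nz_def Np_def by (simp add: sum.distrib distrib_right)
  also have "\<dots> \<le> ?m + 2 * Np + L" using J(2) hm by simp
  also have "\<dots> \<le> 2 * nevanlinna_char f R + L"
    unfolding T using m0 by simp
  finally show "(\<Sum>p\<in>D - {0}. \<bar>of_int (?k p)\<bar> * ln (R / cmod p)) + \<bar>of_int (?k 0)\<bar> * ln R
      \<le> 2 * nevanlinna_char f R + L" .
qed

text \<open>A point with \<open>0 < cmod p \<le> r \<le> R / 2\<close> has weight
  \<open>ln (R / cmod p) \<ge> ln 2\<close> in the first bound of
  \<open>characteristic_bounds\<close>, and the origin has weight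
  \<open>ln R \<ge> ln 2\<close>.\<close>

lemma zero_pole_count_le:
  assumes f: "f meromorphic_on UNIV" "\<not> (\<forall>\<^sub>\<approx>z\<in>UNIV. f z = 0)"
    and circ: "critical_set f \<inter> sphere 0 R = {}" and r: "1 \<le> r" "2 * r \<le> R"
  shows "(\<Sum>p\<in>critical_set f \<inter> cball 0 r. \<bar>of_int (zorder f p)\<bar>) * ln 2
           \<le> 2 * nevanlinna_char f R + \<bar>ln (cmod (zor_poly f 0 0))\<bar>"
proof -
  define D where "D = critical_set f \<inter> cball 0 R"
  define E where "E = critical_set f \<inter> cball 0 r"
  have fin: "finite D" "finite E" unfolding D_def E_def by (rule finite_critical_set_Int_cball[OF f])+
  have R: "0 < R" "1 \<le> R" "2 \<le> R" using r by auto
  obtain h where h: "h holomorphic_on cball 0 R"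
    "\<And>z. z \<in> cball 0 R - D \<Longrightarrow> f z = exp (h z) * (\<Prod>p\<in>D. blaschke R p z powi zorder f p)"
    using meromorphic_Blaschke_factorization[OF f D_def circ R(1)] by blast
  have "0 \<in> E" using r by (simp add: E_def critical_set_def)
  then have "(\<Sum>p\<in>E. \<bar>of_int (zorder f p)\<bar>) * ln (2 :: real)
      = (\<Sum>p\<in>E - {0}. \<bar>of_int (zorder f p)\<bar> * ln 2) + \<bar>of_int (zorder f 0)\<bar> * ln 2"
    using fin sum.remove[of E 0 "\<lambda>p. \<bar>of_int (zorder f p)\<bar> * ln 2 :: real"] by (simp add: sum_distrib_right)
  also have "\<dots> \<le> (\<Sum>p\<in>D - {0}. \<bar>of_int (zorder f p)\<bar> * ln (R / cmod p)) + \<bar>of_int (zorder f 0)\<bar> * ln R"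
  proof (intro add_mono mult_left_mono)
    show "ln 2 \<le> ln R" using R by simp
    have "(\<Sum>p\<in>E - {0}. \<bar>of_int (zorder f p)\<bar> * ln 2 :: real) \<le> (\<Sum>p\<in>E - {0}. \<bar>of_int (zorder f p)\<bar> * ln (R / cmod p))"
    proof (intro sum_mono mult_left_mono)
      fix p assume p: "p \<in> E - {0}"
      then have "2 * cmod p \<le> R" "0 < cmod p" using r by (auto simp: E_def)
      then have "2 \<le> R / cmod p" by (simp add: field_simps)
      then show "ln 2 \<le> ln (R / cmod p)" by simp
    qed simp
    also have "\<dots> \<le> (\<Sum>p\<in>D - {0}. \<bar>of_int (zorder f p)\<bar> * ln (R / cmod p))"
    proof (rule sum_mono2)
      show "E - {0} \<subseteq> D - {0}" using r by (auto simp: D_def E_def)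
      fix p assume "p \<in> D - {0} - (E - {0})"
      then have "0 < cmod p" "cmod p \<le> R" by (auto simp: D_def)
      then show "0 \<le> \<bar>of_int (zorder f p)\<bar> * ln (R / cmod p)"
        by (intro mult_nonneg_nonneg ln_ge_zero) auto
    qed (use fin in auto)
    finally show "(\<Sum>p\<in>E - {0}. \<bar>of_int (zorder f p)\<bar> * ln 2 :: real)
        \<le> (\<Sum>p\<in>D - {0}. \<bar>of_int (zorder f p)\<bar> * ln (R / cmod p))" .
  qed simp
  also have "\<dots> \<le> 2 * nevanlinna_char f R + \<bar>ln (cmod (zor_poly f 0 0))\<bar>"
    by (rule characteristic_bounds(1)[OF f D_def circ R(2) h])
  finally show ?thesis by (simp add: E_def)
qed

section \<open>Logarithms of quotients of values at nearby points\<close>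

lemma ln_norm_quotient_le:
  fixes u v :: complex
  assumes "u \<noteq> 0" "v \<noteq> 0"
  shows "ln (cmod u) - ln (cmod v) \<le> ln (1 + cmod (u - v) / cmod v)"
proof -
  have "cmod u \<le> cmod v * (1 + cmod (u - v) / cmod v)"
    using norm_triangle_sub[of u v] assms by (simp add: distrib_left)
  then have "ln (cmod u) \<le> ln (cmod v * (1 + cmod (u - v) / cmod v))"
    using assms by (subst ln_le_cancel_iff) (auto intro!: mult_pos_pos add_pos_nonneg)
  also have "\<dots> = ln (cmod v) + ln (1 + cmod (u - v) / cmod v)"
    using assms by (intro ln_mult_pos) (auto intro: add_pos_nonneg)
  finally show ?thesis by simp
qed

text \<open>The numerators contribute the logarithmic term, which is singular at \<open>p\<close>.
  The denominators have modulus at least \<open>R * R / 2\<close> on the disc of radius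
  \<open>R / 2\<close>, so they contribute at most \<open>2 * cmod (w1 - w2) / R\<close>.\<close>

lemma blaschke_log_difference:
  assumes p: "cmod p < R" and w: "cmod w1 \<le> R / 2" "cmod w2 \<le> R / 2" "w1 \<noteq> p" "w2 \<noteq> p"
  shows "ln (cmod (blaschke R p w1)) - ln (cmod (blaschke R p w2))
    \<le> ln (1 + cmod (w1 - w2) / cmod (w2 - p)) + 2 * cmod (w1 - w2) / R"
proof -
  have R: "0 < R" using p by (smt (verit) norm_ge_zero)
  let ?q = "\<lambda>z. (of_real R)\<^sup>2 - cnj p * z"
  have q: "R * R / 2 \<le> cmod (?q z)" "?q z \<noteq> 0" if "cmod z \<le> R / 2" for z
  proof -
    have "cmod p * cmod z \<le> R * (R / 2)" using that p R by (intro mult_mono) auto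
    then show "R * R / 2 \<le> cmod (?q z)"
      using norm_triangle_ineq2[of "(of_real R)\<^sup>2" "cnj p * z"] R by (simp add: norm_mult power2_eq_square norm_power)
    show "?q z \<noteq> 0" by (rule radius_square_neq_cnj_mult[OF p]) (use that R in auto)
  qed
  have lb: "ln (cmod (blaschke R p z)) = ln R + ln (cmod (z - p)) - ln (cmod (?q z))"
    if "cmod z \<le> R / 2" "z \<noteq> p" for z
    using R q(2)[OF that(1)] that(2) by (simp add: blaschke_def norm_mult norm_divide ln_mult ln_div)
  have "ln (cmod (?q w2)) - ln (cmod (?q w1)) \<le> ln (1 + cmod (?q w2 - ?q w1) / cmod (?q w1))"
    by (rule ln_norm_quotient_le) (use q w in auto)
  also have "\<dots> \<le> cmod (?q w2 - ?q w1) / cmod (?q w1)"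
    by (rule ln_add_one_self_le_self) simp
  also have "?q w2 - ?q w1 = cnj p * (w1 - w2)" by (simp add: algebra_simps)
  also have "cmod (cnj p * (w1 - w2)) / cmod (?q w1) \<le> R * cmod (w1 - w2) / (R * R / 2)"
    using q(1)[OF w(1)] R p by (intro frac_le) (auto simp: norm_mult intro!: mult_right_mono)
  also have "\<dots> = 2 * cmod (w1 - w2) / R" using R by simp
  finally have 1: "ln (cmod (?q w2)) - ln (cmod (?q w1)) \<le> 2 * cmod (w1 - w2) / R" .
  have "ln (cmod (w1 - p)) - ln (cmod (w2 - p)) \<le> ln (1 + cmod (w1 - w2) / cmod (w2 - p))"
    using ln_norm_quotient_le[of "w1 - p" "w2 - p"] w by simp
  with 1 show ?thesis using lb[OF w(1,3)] lb[OF w(2,4)] by linarith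
qed

text \<open>Take logarithms in the Blaschke factorization. The part from \<open>h\<close> is bounded
  by the oscillation estimate together with the bound for the mean of
  \<open>\<bar>Re h\<bar>\<close>, the other part factor by factor.\<close>

lemma log_quotient_bound:
  assumes f: "f meromorphic_on UNIV" "\<not> (\<forall>\<^sub>\<approx>z\<in>UNIV. f z = 0)"
    and D: "D = critical_set f \<inter> cball 0 R" and circ: "critical_set f \<inter> sphere 0 R = {}" and R: "1 \<le> R"
    and w: "cmod w1 \<le> R / 2" "cmod w2 \<le> R / 2" "w1 \<notin> D" "w2 \<notin> D" and d: "cmod (w1 - w2) \<le> d"
  shows "ln (cmod (f w1)) - ln (cmod (f w2))
     \<le> 8 * d / R * (2 * nevanlinna_char f R + \<bar>ln (cmod (zor_poly f 0 0))\<bar>)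
       + (\<Sum>p\<in>D. \<bar>of_int (zorder f p)\<bar> * (ln (1 + d / cmod (w1 - p)) + ln (1 + d / cmod (w2 - p)) + 2 * d / R))"
proof -
  let ?k = "zorder f" and ?A = "2 * nevanlinna_char f R + \<bar>ln (cmod (zor_poly f 0 0))\<bar>"
  have R0: "0 < R" using R by simp
  have d0: "0 \<le> d" using d norm_ge_zero order_trans by blast
  have fin: "finite D" unfolding D by (rule finite_critical_set_Int_cball[OF f])
  have DR: "cmod p < R" if "p \<in> D" for p
    using that circ unfolding D by (force simp: order.order_iff_strict)
  obtain h where h: "h holomorphic_on cball 0 R"
    "\<And>z. z \<in> cball 0 R - D \<Longrightarrow> f z = exp (h z) * (\<Prod>p\<in>D. blaschke R p z powi ?k p)"
    using meromorphic_Blaschke_factorization[OF f D circ R0] by blast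
  have lf: "ln (cmod (f z)) = Re (h z) + (\<Sum>p\<in>D. of_int (?k p) * ln (cmod (blaschke R p z)))"
    if z: "cmod z \<le> R / 2" "z \<notin> D" for z
  proof -
    have b: "0 < cmod (blaschke R p z)" if "p \<in> D" for p
      using blaschke_eq_0_iff[OF DR[OF that], of z] z that R by auto
    have "cmod (f z) = exp (Re (h z)) * (\<Prod>p\<in>D. cmod (blaschke R p z) powi ?k p)"
      using z R by (subst h(2)) (auto simp: norm_mult norm_exp_eq_Re norm_power_int prod_norm[symmetric])
    moreover have "0 < (\<Prod>p\<in>D. cmod (blaschke R p z) powi ?k p)"
      using b by (intro prod_pos ballI zero_less_power_int)
    ultimately have "ln (cmod (f z)) = Re (h z) + ln (\<Prod>p\<in>D. cmod (blaschke R p z) powi ?k p)"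
      by (simp add: ln_mult_pos)
    also have "ln (\<Prod>p\<in>D. cmod (blaschke R p z) powi ?k p) = (\<Sum>p\<in>D. ln (cmod (blaschke R p z) powi ?k p))"
      using b fin by (intro ln_prod) (auto simp: less_le)
    also have "\<dots> = (\<Sum>p\<in>D. of_int (?k p) * ln (cmod (blaschke R p z)))"
      by (intro sum.cong refl ln_power_int b)
    finally show ?thesis .
  qed
  have A0: "0 \<le> ?A" by (rule characteristic_bounds(3)[OF f D circ R h])
  have "Re (h w1) - Re (h w2) \<le> cmod (h w1 - h w2)"
    using complex_Re_le_cmod[of "h w1 - h w2"] by simp
  also have "\<dots> \<le> 8 * cmod (w1 - w2) / R * (integral {0..2 * pi} (\<lambda>t. \<bar>Re (h (of_real R * exp (\<i> * of_real t)))\<bar>) / (2 * pi))"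
    by (rule Re_oscillation_le_mean[OF h(1) R0 w(1,2)])
  also have "\<dots> \<le> 8 * cmod (w1 - w2) / R * ?A"
    by (intro mult_left_mono characteristic_bounds(2)[OF f D circ R h]) (use R in auto)
  also have "\<dots> \<le> 8 * d / R * ?A"
    using d R A0 by (intro mult_right_mono divide_right_mono) auto
  finally have 1: "Re (h w1) - Re (h w2) \<le> 8 * d / R * ?A" .
  \<comment> \<open>The order may have either sign, so the difference is bounded in absolute value;
    this is why singular terms at both \<open>w1\<close> and \<open>w2\<close> appear.\<close>
  have 2: "of_int (?k p) * (ln (cmod (blaschke R p w1)) - ln (cmod (blaschke R p w2)))
      \<le> \<bar>of_int (?k p)\<bar> * (ln (1 + d / cmod (w1 - p)) + ln (1 + d / cmod (w2 - p)) + 2 * d / R)"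
    if p: "p \<in> D" for p
  proof -
    have ne: "w1 \<noteq> p" "w2 \<noteq> p" using w p by auto
    have m: "ln (1 + cmod (w1 - w2) / cmod (w - p)) \<le> ln (1 + d / cmod (w - p))" "0 \<le> ln (1 + d / cmod (w - p))"
      if "w \<noteq> p" for w
    proof -
      have "cmod (w1 - w2) / cmod (w - p) \<le> d / cmod (w - p)" using d by (intro divide_right_mono) auto
      then show "ln (1 + cmod (w1 - w2) / cmod (w - p)) \<le> ln (1 + d / cmod (w - p))"
        by (subst ln_le_cancel_iff) (auto intro!: add_pos_nonneg simp: d0)
      show "0 \<le> ln (1 + d / cmod (w - p))" using d0 by (intro ln_ge_zero) simp
    qed
    have "2 * cmod (w1 - w2) / R \<le> 2 * d / R" using d R by (intro divide_right_mono) auto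
    then have "\<bar>ln (cmod (blaschke R p w1)) - ln (cmod (blaschke R p w2))\<bar>
        \<le> ln (1 + d / cmod (w1 - p)) + ln (1 + d / cmod (w2 - p)) + 2 * d / R"
      using blaschke_log_difference[OF DR[OF p] w(1,2) ne] blaschke_log_difference[OF DR[OF p] w(2,1) ne(2,1)]
        m[OF ne(1)] m[OF ne(2)] by (simp only: norm_minus_commute[of w2 w1])
    then have "\<bar>of_int (?k p)\<bar> * \<bar>ln (cmod (blaschke R p w1)) - ln (cmod (blaschke R p w2))\<bar>
      \<le> \<bar>of_int (?k p)\<bar> * (ln (1 + d / cmod (w1 - p)) + ln (1 + d / cmod (w2 - p)) + 2 * d / R)"
      by (intro mult_left_mono) auto
    then show ?thesis
      unfolding abs_mult[symmetric] by linarith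
  qed
  have "ln (cmod (f w1)) - ln (cmod (f w2)) = Re (h w1) - Re (h w2)
      + (\<Sum>p\<in>D. of_int (?k p) * (ln (cmod (blaschke R p w1)) - ln (cmod (blaschke R p w2))))"
    using lf w by (simp add: sum_subtractf right_diff_distrib)
  also have "\<dots> \<le> 8 * d / R * ?A
       + (\<Sum>p\<in>D. \<bar>of_int (?k p)\<bar> * (ln (1 + d / cmod (w1 - p)) + ln (1 + d / cmod (w2 - p)) + 2 * d / R))"
    by (intro add_mono sum_mono 1 2)
  finally show ?thesis .
qed

subsection \<open>Functions of order less than one\<close>

lemma growth_order_less_1D:
  assumes "growth_order f < 1"
  obtains \<rho> where "0 < \<rho>" "\<rho> < 1" "\<forall>\<^sub>F r in at_top. nevanlinna_char f r \<le> r powr \<rho>"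
proof -
  obtain y where y: "growth_order f < y" "y < 1"
    using dense[OF assms] by blast
  have ev: "\<forall>\<^sub>F r in at_top. ereal (log_plus (nevanlinna_char f r) / ln r) < y"
    using Limsup_lessD y(1) unfolding growth_order_def by blast
  \<comment> \<open>The maximum with \<open>1/2\<close> makes the exponent positive whatever
    \<open>y\<close> is, and keeps it below \<open>1\<close>.\<close>
  define \<rho> where "\<rho> = max (1/2) (real_of_ereal y)"
  have y': "y \<le> ereal \<rho>" "\<rho> < 1"
    using y(2) by (cases y; simp add: \<rho>_def)+
  have "\<forall>\<^sub>F r in at_top. nevanlinna_char f r \<le> r powr \<rho>"
    using ev eventually_gt_at_top[of 1]
  proof eventually_elim
    case (elim r)
    let ?T = "nevanlinna_char f r"
    have "ereal (log_plus ?T / ln r) < ereal \<rho>"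
      using elim(1) y'(1) by (rule less_le_trans)
    then have "ln (max 1 ?T) \<le> \<rho> * ln r"
      using elim(2) by (simp add: log_plus_def divide_less_eq)
    also have "\<dots> = ln (r powr \<rho>)" using elim(2) by (simp add: ln_powr)
    finally have "max 1 ?T \<le> r powr \<rho>" using elim(2) by (subst (asm) ln_le_cancel_iff) auto
    then show ?case by simp
  qed
  then show ?thesis using that[of \<rho>] y'(2) by (auto simp: \<rho>_def)
qed

lemma exists_radius_avoiding_critical_set:
  assumes "f meromorphic_on UNIV" "\<not> (\<forall>\<^sub>\<approx>z\<in>UNIV. f z = 0)" "a < b"
  obtains R where "a < R" "R < b" "critical_set f \<inter> sphere 0 R = {}"
proof -
  have "finite (cmod ` (critical_set f \<inter> cball 0 b))"
    using finite_critical_set_Int_cball[OF assms(1,2)] by simp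
  then have "infinite ({a<..<b} - cmod ` (critical_set f \<inter> cball 0 b))"
    using assms(3) by (simp add: infinite_Ioo)
  then have "{a<..<b} - cmod ` (critical_set f \<inter> cball 0 b) \<noteq> {}" by (metis finite.emptyI)
  then obtain R where R: "R \<in> {a<..<b} - cmod ` (critical_set f \<inter> cball 0 b)" by blast
  have "critical_set f \<inter> sphere 0 R = {}"
  proof (rule equals0I)
    fix z assume z: "z \<in> critical_set f \<inter> sphere 0 R"
    then have "z \<in> critical_set f \<inter> cball 0 b" using R by simp
    then have "cmod z \<in> cmod ` (critical_set f \<inter> cball 0 b)" by (rule imageI)
    then show False using R z by simp
  qed
  then show ?thesis using that[of R] R by simp
qed

section \<open>Dominance of one coefficient, and points where the shifts of f are comparable\<close>

lemma dominant_polynomial_eventually: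
  assumes dom: "(SUP j\<in>{0..n} - {l}. poly_deg (P j)) < poly_deg (P l)"
    and c: "0 < c"
  shows "\<forall>\<^sub>F x::real in at_top. c * (\<Sum>j\<in>{0..n} - {l}. cmod (poly (P j) (of_real x))) < cmod (poly (P l) (of_real x))"
proof -
  \<comment> \<open>A degree strictly above a supremum cannot be \<open>-\<infinity>\<close>, even
    when the index set is empty.\<close>
  have Pl: "P l \<noteq> 0" using dom by (auto simp: poly_deg_def)
  have lim: "((\<lambda>x::real. cmod (poly (P j) (of_real x) / poly (P l) (of_real x))) \<longlongrightarrow> 0) at_top"
    if j: "j \<in> {0..n} - {l}" for j
  proof (cases "P j = 0")
    case False
    have "poly_deg (P j) < poly_deg (P l)"
      by (rule le_less_trans[OF SUP_upper[OF j] dom])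
    then have "degree (P j) < degree (P l)" using False Pl by (simp add: poly_deg_def)
    then have "((\<lambda>z. poly (P j) z / poly (P l) z) \<longlongrightarrow> 0) at_infinity"
      by (rule poly_divide_tendsto_0_at_infinity)
    from filterlim_compose[OF this, of complex_of_real at_top]
    have "((\<lambda>x::real. poly (P j) (of_real x) / poly (P l) (of_real x)) \<longlongrightarrow> 0) at_top"
      by (simp add: filterlim_at_infinity_conv_norm_at_top filterlim_abs_real)
    then show ?thesis by (rule tendsto_norm_zero)
  qed simp
  have "((\<lambda>x::real. c * (\<Sum>j\<in>{0..n} - {l}. cmod (poly (P j) (of_real x) / poly (P l) (of_real x)))) \<longlongrightarrow> c * (\<Sum>j\<in>{0..n} - {l}. 0)) at_top"
    by (intro tendsto_mult tendsto_const tendsto_sum lim)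
  then have "\<forall>\<^sub>F x::real in at_top. c * (\<Sum>j\<in>{0..n} - {l}. cmod (poly (P j) (of_real x) / poly (P l) (of_real x))) < 1"
    by (rule order_tendstoD) simp
  moreover have "\<forall>\<^sub>F x::real in at_top. poly (P l) (of_real x) \<noteq> 0"
  proof -
    have "finite {x::real. poly (P l) (of_real x) = 0}"
      by (rule finite_imageD[of of_real], rule finite_subset[OF _ poly_roots_finite[OF Pl]]) (auto simp: inj_on_def)
    then obtain b where b: "\<forall>x\<in>{x::real. poly (P l) (of_real x) = 0}. x \<le> b"
      using bdd_above_finite bdd_above_def by metis
    show ?thesis using eventually_gt_at_top[of b] by eventually_elim (use b in force)
  qed
  ultimately show ?thesis
  proof eventually_elim
    case (elim x)
    then have "0 < cmod (poly (P l) (of_real x))" by simp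
    then show ?case using elim
      by (simp add: norm_divide sum_divide_distrib[symmetric] divide_less_eq)
  qed
qed

text \<open>The expression is the total bound for the logarithm of a quotient, with
  \<open>M R\<close> bounding the number of zeros and poles. After expansion only the powers of
  \<open>R\<close> with exponents \<open>\<rho> - 1\<close>, \<open>-1\<close>,
  \<open>\<rho> + e - 1\<close> and \<open>e - 1\<close> occur, and the choice of \<open>e\<close>
  makes them all negative.\<close>

lemma ratio_bound_tendsto_0:
  fixes \<rho> C L n :: real
  assumes \<rho>: "0 < \<rho>" "\<rho> < 1"
  defines "M \<equiv> \<lambda>R. (2 * (3 * R) powr \<rho> + L) / ln 2" and "e \<equiv> (1 - \<rho>) / 2"
  shows "((\<lambda>R. 8 * n / R * (2 * R powr \<rho> + L) + 2 * C * (((n + 1) * M R * (2 * (2 * R) powr e / e) + 1) / (R / 8))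
            + M R * (2 * n / R)) \<longlongrightarrow> 0) at_top"
proof -
  let ?g = "\<lambda>R. 16 * n * R powr (\<rho> - 1) + 8 * n * L * R powr - 1
      + 16 * C * ((n + 1) * (2 * 2 powr e / e) / ln 2 * (2 * 3 powr \<rho> * R powr (\<rho> + e - 1) + L * R powr (e - 1)) + R powr - 1)
      + 2 * n / ln 2 * (2 * 3 powr \<rho> * R powr (\<rho> - 1) + L * R powr - 1)"
  have e: "0 < e" "\<rho> + e < 1" "e < 1" using \<rho> by (auto simp: e_def field_simps)
  have z: "((\<lambda>R. R powr a) \<longlongrightarrow> 0) at_top" if "a < 0" for a :: real
    using tendsto_neg_powr[OF that filterlim_ident] by simp
  have "(?g \<longlongrightarrow> 16 * n * 0 + 8 * n * L * 0
      + 16 * C * ((n + 1) * (2 * 2 powr e / e) / ln 2 * (2 * 3 powr \<rho> * 0 + L * 0) + 0)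
      + 2 * n / ln 2 * (2 * 3 powr \<rho> * 0 + L * 0)) at_top"
    by (intro tendsto_add tendsto_mult_left z) (use e \<rho> in auto)
  then have "(?g \<longlongrightarrow> 0) at_top" by simp
  moreover have "\<forall>\<^sub>F R in at_top. ?g R = 8 * n / R * (2 * R powr \<rho> + L)
      + 2 * C * (((n + 1) * M R * (2 * (2 * R) powr e / e) + 1) / (R / 8)) + M R * (2 * n / R)"
    using eventually_gt_at_top[of 0]
  proof eventually_elim
    case (elim R)
    have p: "R powr (\<rho> - 1) = R powr \<rho> / R" "R powr - 1 = 1 / R" "R powr (e - 1) = R powr e / R"
      "R powr (\<rho> + e - 1) = R powr \<rho> * R powr e / R"
      using elim by (simp_all add: powr_diff powr_add powr_minus_divide)
    have q: "(3 * R) powr \<rho> = 3 powr \<rho> * R powr \<rho>" "(2 * R) powr e = 2 powr e * R powr e"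
      using elim by (simp_all add: powr_mult)
    have "ln (2::real) \<noteq> 0" by simp
    then show ?case
      unfolding M_def p q using elim e(1)
      by (simp add: divide_simps) (simp add: algebra_simps)
  qed
  ultimately show ?thesis by (rule Lim_transform_eventually)
qed

text \<open>Averaging over \<open>x\<close> between \<open>R / 8\<close> and \<open>R / 4\<close>
  makes the singular terms at all shifts small at once. The logarithm of each quotient is then at
  most \<open>B R < 1\<close>, which yields the constant \<open>exp 1\<close>.\<close>

lemma exists_large_point_bounded_ratio:
  fixes n :: nat and X :: real
  assumes f: "f meromorphic_on UNIV" "\<not> (\<forall>\<^sub>\<approx>z\<in>UNIV. f z = 0)"
    and order: "growth_order f < 1" and S: "S sparse_in (UNIV :: complex set)"
  obtains x where "X \<le> x" "of_real x \<notin> S"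
    "\<And>j. j \<le> n \<Longrightarrow> f (of_real x + of_nat j) \<noteq> 0"
    "\<And>i j. i \<le> n \<Longrightarrow> j \<le> n \<Longrightarrow> cmod (f (of_real x + of_nat i)) \<le> exp 1 * cmod (f (of_real x + of_nat j))"
proof -
  obtain \<rho> where \<rho>: "0 < \<rho>" "\<rho> < 1" "\<forall>\<^sub>F r in at_top. nevanlinna_char f r \<le> r powr \<rho>"
    using growth_order_less_1D[OF order] by blast
  \<comment> \<open>The singularities get the exponent \<open>e - 1 = - (1 + \<rho>) / 2\<close>:
    integrable on the line, yet decaying faster than the number of zeros and poles grows.
    \<open>C\<close> is the constant from \<open>ln_one_plus_le_powr\<close> with exponent
    \<open>1 - e\<close>.\<close>
  define e where "e = (1 - \<rho>) / 2"
  have e: "0 < e" "e < 1" using \<rho> by (auto simp: e_def)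
  define C where "C = real n powr (1 - e) / (1 - e)"
  define L where "L = \<bar>ln (cmod (zor_poly f 0 0))\<bar>"
  define Mb where "Mb = (\<lambda>R. (2 * (3 * R) powr \<rho> + L) / ln 2)"
  define B where "B = (\<lambda>R. 8 * real n / R * (2 * R powr \<rho> + L)
      + 2 * C * (((real n + 1) * Mb R * (2 * (2 * R) powr e / e) + 1) / (R / 8)) + Mb R * (2 * real n / R))"
  have "(B \<longlongrightarrow> 0) at_top"
    unfolding B_def Mb_def e_def by (rule ratio_bound_tendsto_0[OF \<rho>(1,2)])
  then have "\<forall>\<^sub>F R in at_top. B R < 1" by (rule order_tendstoD) simp
  moreover note \<rho>(3)
  moreover have "\<forall>\<^sub>F R in at_top. max 1 (max (4 * real n) (8 * X)) \<le> R"
    by (rule eventually_ge_at_top)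
  ultimately have "\<forall>\<^sub>F R in at_top. B R < 1 \<and> nevanlinna_char f R \<le> R powr \<rho> \<and> max 1 (max (4 * real n) (8 * X)) \<le> R"
    by (intro eventually_conj)
  then obtain R0 where R0: "\<And>R. R0 \<le> R \<Longrightarrow> B R < 1 \<and> nevanlinna_char f R \<le> R powr \<rho> \<and> max 1 (max (4 * real n) (8 * X)) \<le> R"
    unfolding eventually_at_top_linorder by blast
  obtain R where R: "R0 < R" "R < R0 + 1" and circ: "critical_set f \<inter> sphere 0 R = {}"
    using exists_radius_avoiding_critical_set[OF f, of R0 "R0 + 1"] by auto
  have large: "B R < 1" "nevanlinna_char f R \<le> R powr \<rho>" "1 \<le> R" "4 * real n \<le> R" "8 * X \<le> R"
    using R0[of R] R by auto
  \<comment> \<open>The zeros and poles up to radius \<open>R\<close> are counted through a second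
    circle of at least twice the radius; \<open>R' < 3 * R\<close> explains the \<open>3 * R\<close>
    in \<open>Mb\<close>.\<close>
  obtain R' where R': "2 * R < R'" "R' < 3 * R" and circ': "critical_set f \<inter> sphere 0 R' = {}"
    using exists_radius_avoiding_critical_set[OF f, of "2 * R" "3 * R"] large(3) by auto
  define D where "D = critical_set f \<inter> cball 0 R"
  define k where "k p = \<bar>real_of_int (zorder f p)\<bar>" for p
  have fin: "finite D" unfolding D_def by (rule finite_critical_set_Int_cball[OF f])
  define M where "M = (\<Sum>p\<in>D. k p)"
  have M: "0 \<le> M" "M \<le> Mb R"
  proof -
    show "0 \<le> M" unfolding M_def k_def by (simp add: sum_nonneg)
    have "M * ln 2 \<le> 2 * nevanlinna_char f R' + L"
      unfolding M_def k_def D_def L_def by (rule zero_pole_count_le[OF f circ']) (use large R' in auto)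
    also have "nevanlinna_char f R' \<le> R' powr \<rho>" using R0[of R'] R R' large by auto
    also have "R' powr \<rho> \<le> (3 * R) powr \<rho>" using R' large \<rho> by (intro powr_mono2) auto
    finally show "M \<le> Mb R" by (simp add: Mb_def pos_le_divide_eq)
  qed
  \<comment> \<open>A pair \<open>(p, j)\<close> stands for the singularity of the
    \<open>j\<close>-th shift at \<open>p\<close>; seen on the real line it is centred at
    \<open>c (p, j) = Re p - j\<close>.\<close>
  define I where "I = D \<times> {0..n}"
  define c where "c = (\<lambda>(p, j). Re p - real j)"
  define a b where "a = R / 8" and "b = R / 4"
  have ab: "a < b" "0 < a" "b \<le> R" using large by (auto simp: a_def b_def)
  have b4: "b + real n \<le> R / 2" using large by (simp add: b_def)
  \<comment> \<open>Besides \<open>S\<close> and the critical points of the shifts, the centres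
    themselves are avoided: there \<open>powr\<close> has base \<open>0\<close> and returns
    \<open>0\<close>, which bounds nothing.\<close>
  define F where "F = {x \<in> {a..b}. of_real x \<in> S}
      \<union> (\<Union>j\<in>{0..n}. {x \<in> {a..b}. of_real x + of_nat j \<in> critical_set f}) \<union> c ` I"
  have "finite F"
  proof -
    have "finite (S \<inter> cball 0 R)"
      using sparse_in_compact_finite[OF sparse_in_subset[OF S], of "cball 0 R"] by (simp add: Int_commute)
    moreover have "{x \<in> {a..b}. of_real x \<in> S} \<subseteq> Re ` (S \<inter> cball 0 R)"
    proof
      fix x assume x: "x \<in> {x \<in> {a..b}. of_real x \<in> S}"
      then have "complex_of_real x \<in> S \<inter> cball 0 R" using ab by auto
      then show "x \<in> Re ` (S \<inter> cball 0 R)" by (rule image_eqI[rotated]) simp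
    qed
    ultimately have "finite {x \<in> {a..b}. of_real x \<in> S}" using finite_subset by blast
    moreover have "finite {x \<in> {a..b}. of_real x + of_nat j \<in> critical_set f}" if "j \<in> {0..n}" for j
    proof (rule finite_subset)
      show "{x \<in> {a..b}. of_real x + of_nat j \<in> critical_set f} \<subseteq> (\<lambda>z. Re z - real j) ` D"
      proof
        fix x assume x: "x \<in> {x \<in> {a..b}. complex_of_real x + of_nat j \<in> critical_set f}"
        have "cmod (of_real x + of_nat j) \<le> \<bar>x\<bar> + real j"
          using norm_triangle_ineq[of "complex_of_real x" "of_nat j"] by simp
        then have "complex_of_real x + of_nat j \<in> D" using x ab b4 that large(3) by (auto simp: D_def)
        then show "x \<in> (\<lambda>z. Re z - real j) ` D" by (rule image_eqI[rotated]) simp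
      qed
    qed (use fin in simp)
    moreover have "finite I" using fin by (simp add: I_def)
    ultimately show ?thesis by (auto simp: F_def)
  qed
  have cK: "\<bar>y - c i\<bar> \<le> 2 * R" if iy: "i \<in> I" "0 \<le> y" "y \<le> b" for i y
  proof -
    obtain p j where i: "i = (p, j)" "p \<in> D" "j \<le> n" using iy(1) by (cases i) (auto simp: I_def)
    have "\<bar>Re p\<bar> \<le> R" using i abs_Re_le_cmod[of p] by (simp add: D_def)
    then show ?thesis using i iy b4 large(3) by (simp add: c_def)
  qed
  have "\<exists>x\<in>{a..b} - F. (\<Sum>i\<in>I. k (fst i) * \<bar>x - c i\<bar> powr (e - 1))
      \<le> ((\<Sum>i\<in>I. k (fst i)) * (2 * (2 * R) powr e / e) + 1) / (b - a)"
    by (rule exists_small_singular_sum)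
       (use ab e \<open>finite F\<close> fin cK in \<open>auto simp: I_def k_def\<close>)
  then obtain x where x: "x \<in> {a..b}" "x \<notin> F"
    and xs: "(\<Sum>i\<in>I. k (fst i) * \<bar>x - c i\<bar> powr (e - 1)) \<le> ((\<Sum>i\<in>I. k (fst i)) * (2 * (2 * R) powr e / e) + 1) / (b - a)"
    by blast
  have "(\<Sum>i\<in>I. k (fst i)) = (real n + 1) * M"
    by (simp add: I_def M_def sum.cartesian_product' sum_distrib_left sum.distrib algebra_simps)
  then have xs': "(\<Sum>i\<in>I. k (fst i) * \<bar>x - c i\<bar> powr (e - 1))
      \<le> ((real n + 1) * M * (2 * (2 * R) powr e / e) + 1) / (R / 8)"
    using xs by (simp add: a_def b_def)
  define w where "w j = complex_of_real x + of_nat j" for j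
  have wR: "cmod (w j) \<le> R / 2" if "j \<le> n" for j
  proof -
    have "cmod (w j) \<le> \<bar>x\<bar> + real j"
      using norm_triangle_ineq[of "complex_of_real x" "of_nat j"] by (simp add: w_def)
    then show ?thesis using x ab b4 that by auto
  qed
  have wc: "w j \<notin> critical_set f" if "j \<le> n" for j
    using x that by (auto simp: F_def w_def)
  \<comment> \<open>Projection to the real axis only shortens distances, so
    \<open>\<bar>x - c (p, j)\<bar>\<close> may replace \<open>cmod (w j - p)\<close>. The sum over
    \<open>p\<close> for fixed \<open>j\<close> is then part of the nonnegative sum over
    \<open>I\<close> controlled by the choice of \<open>x\<close>.\<close>
  have S1: "(\<Sum>p\<in>D. k p * ln (1 + real n / cmod (w j - p))) \<le> C * (\<Sum>i\<in>I. k (fst i) * \<bar>x - c i\<bar> powr (e - 1))"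
    if j: "j \<le> n" for j
  proof -
    have "(\<Sum>p\<in>D. k p * ln (1 + real n / cmod (w j - p))) \<le> (\<Sum>p\<in>D. k p * (C * \<bar>x - c (p, j)\<bar> powr (e - 1)))"
    proof (intro sum_mono mult_left_mono)
      fix p assume p: "p \<in> D"
      have ne: "0 < \<bar>x - c (p, j)\<bar>" using x p j by (auto simp: F_def I_def)
      have le: "\<bar>x - c (p, j)\<bar> \<le> cmod (w j - p)"
        using abs_Re_le_cmod[of "w j - p"] by (simp add: c_def w_def algebra_simps)
      have "ln (1 + real n / cmod (w j - p)) \<le> (real n / cmod (w j - p)) powr (1 - e) / (1 - e)"
        by (rule ln_one_plus_le_powr) (use e in auto)
      also have "\<dots> \<le> (real n / \<bar>x - c (p, j)\<bar>) powr (1 - e) / (1 - e)"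
        using ne le e by (intro divide_right_mono powr_mono2 divide_left_mono mult_pos_pos) auto
      also have "\<dots> = C * \<bar>x - c (p, j)\<bar> powr (e - 1)"
        using powr_minus_divide[of "\<bar>x - c (p, j)\<bar>" "1 - e"] by (simp add: C_def powr_divide)
      finally show "ln (1 + real n / cmod (w j - p)) \<le> C * \<bar>x - c (p, j)\<bar> powr (e - 1)" .
    qed (simp add: k_def)
    also have "\<dots> = C * (\<Sum>i\<in>(\<lambda>p. (p, j)) ` D. k (fst i) * \<bar>x - c i\<bar> powr (e - 1))"
      by (subst sum.reindex) (auto simp: inj_on_def sum_distrib_left mult.left_commute)
    also have "\<dots> \<le> C * (\<Sum>i\<in>I. k (fst i) * \<bar>x - c i\<bar> powr (e - 1))"
      by (intro mult_left_mono sum_mono2) (use fin j e in \<open>auto simp: I_def k_def C_def\<close>)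
    finally show ?thesis .
  qed
  have ratio: "cmod (f (w i)) \<le> exp 1 * cmod (f (w j))" if ij: "i \<le> n" "j \<le> n" for i j
  proof -
    have nz: "f (w i) \<noteq> 0" "f (w j) \<noteq> 0" using wc ij by (auto simp: critical_set_def)
    let ?Q = "((real n + 1) * M * (2 * (2 * R) powr e / e) + 1) / (R / 8)"
    have d: "cmod (w i - w j) \<le> real n"
    proof -
      have "w i - w j = of_int (int i - int j)" by (simp add: w_def)
      then have "cmod (w i - w j) = \<bar>real_of_int (int i - int j)\<bar>" by (simp only: norm_of_int)
      then show ?thesis using ij by simp
    qed
    have "ln (cmod (f (w i))) - ln (cmod (f (w j)))
      \<le> 8 * real n / R * (2 * nevanlinna_char f R + L)
        + (\<Sum>p\<in>D. k p * (ln (1 + real n / cmod (w i - p)) + ln (1 + real n / cmod (w j - p)) + 2 * real n / R))"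
      unfolding L_def k_def
      by (rule log_quotient_bound[OF f D_def circ large(3)])
         (use wR wc ij d in \<open>auto simp: D_def\<close>)
    also have "(\<Sum>p\<in>D. k p * (ln (1 + real n / cmod (w i - p)) + ln (1 + real n / cmod (w j - p)) + 2 * real n / R))
      = (\<Sum>p\<in>D. k p * ln (1 + real n / cmod (w i - p))) + (\<Sum>p\<in>D. k p * ln (1 + real n / cmod (w j - p)))
        + M * (2 * real n / R)"
      by (simp only: M_def distrib_left sum.distrib sum_distrib_right)
    also have "\<dots> \<le> C * ?Q + C * ?Q + M * (2 * real n / R)"
    proof -
      have "C * (\<Sum>i\<in>I. k (fst i) * \<bar>x - c i\<bar> powr (e - 1)) \<le> C * ?Q"
        using e xs' by (intro mult_left_mono) (auto simp: C_def)
      then show ?thesis using S1[OF ij(1)] S1[OF ij(2)] by linarith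
    qed
    also have "8 * real n / R * (2 * nevanlinna_char f R + L) \<le> 8 * real n / R * (2 * R powr \<rho> + L)"
      using large by (intro mult_left_mono) auto
    also have "C * ?Q + C * ?Q + M * (2 * real n / R) = 2 * C * ?Q + M * (2 * real n / R)" by simp
    also have "2 * C * ?Q + M * (2 * real n / R)
      \<le> 2 * C * (((real n + 1) * Mb R * (2 * (2 * R) powr e / e) + 1) / (R / 8)) + Mb R * (2 * real n / R)"
      using M e large by (intro add_mono mult_left_mono mult_right_mono divide_right_mono) (auto simp: C_def)
    finally have "ln (cmod (f (w i))) - ln (cmod (f (w j))) \<le> B R"
      by (simp add: B_def)
    then have "ln (cmod (f (w i))) \<le> 1 + ln (cmod (f (w j)))" using large(1) by linarith
    also have "\<dots> = ln (exp 1 * cmod (f (w j)))" using nz by (simp add: ln_mult_pos)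
    finally show ?thesis using nz by simp
  qed
  show ?thesis
  proof
    show "X \<le> x" using x large(5) by (simp add: a_def)
    show "of_real x \<notin> S" using x by (auto simp: F_def)
    show "f (of_real x + of_nat j) \<noteq> 0" if "j \<le> n" for j
      using wc[OF that] by (simp add: w_def critical_set_def)
    show "cmod (f (of_real x + of_nat i)) \<le> exp 1 * cmod (f (of_real x + of_nat j))" if "i \<le> n" "j \<le> n" for i j
      using ratio[OF that] by (simp add: w_def)
  qed
qed

theorem theorem9p4:
  fixes n :: nat
    and P :: "nat \<Rightarrow> complex poly"
    and f :: "complex \<Rightarrow> complex"
  assumes dominant: "\<exists>l\<in>{0..n}. poly_deg (P l) > (SUP j\<in>{0..n} - {l}. poly_deg (P j))"
    and mero: "f meromorphic_on UNIV"
    and nonzero: "\<not> (\<forall>\<^sub>\<approx>z\<in>UNIV. f z = 0)"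
    and equation: "\<forall>\<^sub>\<approx>z\<in>UNIV. (\<Sum>j=0..n. poly (P j) z * f (z + of_nat j)) = 0"
  shows "growth_order f \<ge> 1"
proof (rule ccontr)
  assume "\<not> growth_order f \<ge> 1"
  then have order: "growth_order f < 1" by simp
  obtain l where l: "l \<in> {0..n}" "(SUP j\<in>{0..n} - {l}. poly_deg (P j)) < poly_deg (P l)"
    using dominant by blast
  \<comment> \<open>The factor \<open>exp 1\<close> matches the bound for the quotients of the
    shifts.\<close>
  obtain X where X: "\<And>x. X \<le> x \<Longrightarrow> exp 1 * (\<Sum>j\<in>{0..n} - {l}. cmod (poly (P j) (of_real x))) < cmod (poly (P l) (of_real x))"
    using dominant_polynomial_eventually[OF l(2), of "exp 1"] unfolding eventually_at_top_linorder by auto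
  \<comment> \<open>The equation may fail on a sparse set, which the point \<open>x\<close> has to
    avoid.\<close>
  have sparse: "{z. \<not> (\<Sum>j=0..n. poly (P j) z * f (z + of_nat j)) = 0} sparse_in UNIV"
    using equation by (simp only: eventually_cosparse)
  obtain x where x: "X \<le> x" "of_real x \<notin> {z. \<not> (\<Sum>j=0..n. poly (P j) z * f (z + of_nat j)) = 0}"
    "\<And>j. j \<le> n \<Longrightarrow> f (of_real x + of_nat j) \<noteq> 0"
    "\<And>i j. i \<le> n \<Longrightarrow> j \<le> n \<Longrightarrow> cmod (f (of_real x + of_nat i)) \<le> exp 1 * cmod (f (of_real x + of_nat j))"
    using exists_large_point_bounded_ratio[OF mero nonzero order sparse, of X n] by blast
  let ?p = "\<lambda>j. poly (P j) (of_real x)" and ?f = "\<lambda>j. f (of_real x + of_nat j)"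
  have "?p l * ?f l = - (\<Sum>j\<in>{0..n} - {l}. ?p j * ?f j)"
    using x(2) sum.remove[OF _ l(1), of "\<lambda>j. ?p j * ?f j"] by (simp add: eq_neg_iff_add_eq_0)
  then have "cmod (?p l) * cmod (?f l) = cmod (\<Sum>j\<in>{0..n} - {l}. ?p j * ?f j)"
    by (metis norm_minus_cancel norm_mult)
  also have "\<dots> \<le> (\<Sum>j\<in>{0..n} - {l}. cmod (?p j) * (exp 1 * cmod (?f l)))"
    using l(1) by (intro sum_norm_le) (auto simp: norm_mult intro!: mult_left_mono x(4))
  also have "\<dots> = (exp 1 * (\<Sum>j\<in>{0..n} - {l}. cmod (?p j))) * cmod (?f l)"
    by (simp add: sum_distrib_left sum_distrib_right mult_ac)
  \<comment> \<open>Strictness survives the multiplication because \<open>?f l\<close> is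
    nonzero.\<close>
  also have "\<dots> < cmod (?p l) * cmod (?f l)"
    using X[OF x(1)] x(3)[of l] l(1) by (intro mult_strict_right_mono) auto
  finally show False by simp
qed

end
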